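(* Let $T$ be a set of cardinality greater than $\aleph_0$, $\mathcal{A}$ a $\sigma$-algebra of subsets of $T$, and let $\mu:\mathcal{A}\to[0,\infty)$ be a monotone set function with $\mu(\emptyset)=0$, $\mu(T)>0$, which is integrable and continuous from below, with integral function $\Psi$. Let $X$ be a Banach space. Then for every bounded multifunction $F:T\to cwk(X)$ the following are equivalent: (i) $F$ is Birkhoff simple integrable with respect to $\mu$; (ii) $F$ is Birkhoff integrable (with respect to the countably additive measure $\Psi$); (iii) $F$ is Gould integrable with respect to $\mu$.
   Context: $(X,\|\cdot\|)$ is a Banach space; $bf(X)$ is the family of nonempty closed bounded subsets of $X$, and $cwk(X)$ the family of nonempty convex weakly compact subsets of $X$. For nonempty $A,B\subset X$ put $e(A,B)=\sup_{x\in A}\inf_{y\in B}\|x-y\|$, $h(A,B)=\max\{e(A,B),e(B,A)\}$, $|A|=\sup_{x\in A}\|x\|$. Finite sums $\sum$ of sets denote the norm closure of the Minkowski sum. $F$ is bounded if $\sup_{t\in T}|F(t)|<\infty$. $\mu$ is monotone if $A\subset B$ implies $\mu(A)\le\mu(B)$; continuous from below if $\lim_n\mu(A_n)=\mu(\bigcup_nA_n)$ for every increasing sequence $(A_n)$ in $\mathcal{A}$. Partitions: a finite (countable) partition of $T$ is a finite (countable) family of nonempty pairwise disjoint members of $\mathcal{A}$ with union $T$. A countable partition may be finite; if it has $N$ members, sums $\sum_{i=1}^n$ with $n\ge N$ mean the sum over all members. $P'\ge P$ means every set of $P'$ is included in some set of $P$. $\mu$ is integrable if the limit of $s(\mu,P)=\sum_{i=1}^k\mu(A_i)$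 over finite partitions $P=\{A_1,\dots,A_k\}$ of $T$ ordered by refinement exists in $[0,\infty)$. Then for every $A\in\mathcal{A}$ the set function $\mu_A(B)=\mu(A\cap B)$ is integrable as well; $\Psi(A)$ denotes the corresponding limit for $\mu_A$. Under the present hypotheses $\Psi$ is a countably additive finite measure on $\mathcal{A}$. Gould integrable with respect to $\mu$: there is $I\in bf(X)$ such that for every $\varepsilon>0$ there is a finite partition $P_\varepsilon$ of $T$ such that for every finite partition $P=\{A_i\}_{i=1}^n\ge P_\varepsilon$ and all $t_i\in A_i$, $h(\sum_{i=1}^nF(t_i)\mu(A_i),I)<\varepsilon$. Birkhoff simple integrable with respect to $\mu$: there is $I\in cwk(X)$ such that for every $\varepsilon>0$ there is a countable partition $P_\varepsilon$ of $T$ such that for every countable partition $P=\{A_n\}_{n\in\mathbb{N}}\ge P_\varepsilon$ (in any enumeration) and all $t_n\in A_n$, $\limsup_nh(\sum_{i=1}^nF(t_i)\mu(A_i),I)\le\varepsilon$. Birkhoff integrable: let $j:cwk(X)\to C(\Omega)$ ($\Omega$ a compact Hausdorff space, sup norm) be a Rådström embedding, i.e. $j(\alpha A+\beta C)=\alpha j(A)+\beta j(C)$ for $\alpha,\beta\ge0$ and $h(A,C)=\|j(A)-j(C)\|_\infty$. $F$ is Birkhoff integrable with respect to a countably additive finite measure $\nu$ if $j\circ F$ is, where a function $f$ from $T$ to a Banach space is Birkhoff integrable with respect to $\nu$ if for every $\varepsilon>0$ there is a countable partition $\Gamma=\{A_n\}$ of $T$ in $\mathcal{A}$ such that $f$ is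 bounded on each $A_n$ with $\nu(A_n)>0$, every series $\sum_n f(t_n)\nu(A_n)$ with $t_n\in A_n$ converges unconditionally, and the set of all sums of these series has diameter less than $\varepsilon$. (This does not depend on the choice of $j$.) *)

theory Defs
  imports "HOL-Analysis.Analysis"
begin

section \<open>Hyperspaces of a Banach space\<close>

text \<open>The coarsest topology making every bounded linear functional continuous: it is pulled back
  from the product topology on functions from the dual space to the reals.\<close>

definition weak_topology :: "'x::real_normed_vector topology" where
  "weak_topology = pullback_topology UNIV (\<lambda>x (f :: 'x \<Rightarrow>\<^sub>L real). blinfun_apply f x) euclidean"

definition bf :: "'x::real_normed_vector set set" where
  "bf = {A. A \<noteq> {} \<and> closed A \<and> bounded A}"

definition cwk :: "'x::real_normed_vector set set" where
  "cwk = {A. A \<noteq> {} \<and> convex A \<and> compactin weak_topology A}"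

text \<open>The excess, the Hausdorff distance and the size of a set take extended real values, so that
  no boundedness is needed for the suprema to be meaningful.\<close>

definition excess :: "'x::real_normed_vector set \<Rightarrow> 'x set \<Rightarrow> ereal" where
  "excess A B = (SUP x\<in>A. INF y\<in>B. ereal (norm (x - y)))"

definition hausdorff_distance :: "'x::real_normed_vector set \<Rightarrow> 'x set \<Rightarrow> ereal" where
  "hausdorff_distance A B = max (excess A B) (excess B A)"

definition set_size :: "'x::real_normed_vector set \<Rightarrow> ereal" where
  "set_size A = (SUP x\<in>A. ereal (norm x))"

definition bounded_multifunction :: "'a set \<Rightarrow> ('a \<Rightarrow> 'x::real_normed_vector set) \<Rightarrow> bool" where
  "bounded_multifunction T F \<longleftrightarrow> (SUP t\<in>T. set_size (F t)) < \<infinity>"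

section \<open>Partitions\<close>

definition countable_partition :: "'a set \<Rightarrow> 'a set set \<Rightarrow> 'a set set \<Rightarrow> bool" where
  "countable_partition T \<A> P \<longleftrightarrow> partition_on T P \<and> P \<subseteq> \<A> \<and> countable P"

definition finite_partition :: "'a set \<Rightarrow> 'a set set \<Rightarrow> 'a set set \<Rightarrow> bool" where
  "finite_partition T \<A> P \<longleftrightarrow> partition_on T P \<and> P \<subseteq> \<A> \<and> finite P"

text \<open>The index set is an initial segment when the enumerated family is finite, and all of the
  naturals otherwise.\<close>

definition enumeration :: "(nat \<Rightarrow> 'a set) \<Rightarrow> nat set \<Rightarrow> 'a set set \<Rightarrow> bool" where
  "enumeration a I P \<longleftrightarrow> (I = UNIV \<or> (\<exists>N. I = {..<N})) \<and> bij_betw a I P"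

section \<open>Integrability of a set function\<close>

definition partition_limit ::
    "'a set \<Rightarrow> 'a set set \<Rightarrow> ('a set \<Rightarrow> real) \<Rightarrow> real \<Rightarrow> bool" where
  "partition_limit T \<A> \<mu> L \<longleftrightarrow>
    (\<forall>\<epsilon>>0. \<exists>P0. finite_partition T \<A> P0 \<and>
      (\<forall>P. finite_partition T \<A> P \<and> refines T P P0 \<longrightarrow> \<bar>(\<Sum>A\<in>P. \<mu> A) - L\<bar> < \<epsilon>))"

definition integrable_set_function ::
    "'a set \<Rightarrow> 'a set set \<Rightarrow> ('a set \<Rightarrow> real) \<Rightarrow> bool" where
  "integrable_set_function T \<A> \<mu> \<longleftrightarrow> (\<exists>L\<ge>0. partition_limit T \<A> \<mu> L)"

definition integral_function ::
    "'a set \<Rightarrow> 'a set set \<Rightarrow> ('a set \<Rightarrow> real) \<Rightarrow> 'a set \<Rightarrow> real" where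
  "integral_function T \<A> \<mu> A = (THE L. partition_limit T \<A> (\<lambda>B. \<mu> (A \<inter> B)) L)"

section \<open>Integrability of multifunctions\<close>

text \<open>Sums of sets are Minkowski sums. The tags are given by a selector \<open>t\<close> on the members of the
  partition.\<close>

definition gould_integrable ::
    "'a set \<Rightarrow> 'a set set \<Rightarrow> ('a set \<Rightarrow> real) \<Rightarrow> ('a \<Rightarrow> 'x::banach set) \<Rightarrow> bool" where
  "gould_integrable T \<A> \<mu> F \<longleftrightarrow>
    (\<exists>I\<in>bf. \<forall>\<epsilon>>0. \<exists>P0. finite_partition T \<A> P0 \<and>
      (\<forall>P t. finite_partition T \<A> P \<and> refines T P P0 \<and> (\<forall>A\<in>P. t A \<in> A) \<longrightarrow>
        hausdorff_distance (closure (\<Sum>A\<in>P. (\<lambda>x. \<mu> A *\<^sub>R x) ` F (t A))) I < ereal \<epsilon>))"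

definition birkhoff_simple_integrable ::
    "'a set \<Rightarrow> 'a set set \<Rightarrow> ('a set \<Rightarrow> real) \<Rightarrow> ('a \<Rightarrow> 'x::banach set) \<Rightarrow> bool" where
  "birkhoff_simple_integrable T \<A> \<mu> F \<longleftrightarrow>
    (\<exists>I\<in>cwk. \<forall>\<epsilon>>0. \<exists>P0. countable_partition T \<A> P0 \<and>
      (\<forall>P a J t. countable_partition T \<A> P \<and> refines T P P0 \<and>
          enumeration a J P \<and> (\<forall>A\<in>P. t A \<in> A) \<longrightarrow>
        limsup (\<lambda>n. hausdorff_distance
          (closure (\<Sum>i\<in>{..<n} \<inter> J. (\<lambda>x. \<mu> (a i) *\<^sub>R x) ` F (t (a i)))) I) \<le> ereal \<epsilon>))"

text \<open>Unconditional convergence of the series is summability of the family indexed by the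
  partition. The library's \<^const>\<open>diameter\<close> is only meaningful on bounded sets, hence the extra
  conjunct. The values lie in a normed space rather than in a type of class \<^class>\<open>banach\<close>, as
  the library proves the type of bounded continuous functions complete only over metric spaces.\<close>

definition birkhoff_integrable_fun ::
    "'a set \<Rightarrow> 'a set set \<Rightarrow> ('a set \<Rightarrow> real) \<Rightarrow> ('a \<Rightarrow> 'b::real_normed_vector) \<Rightarrow> bool" where
  "birkhoff_integrable_fun T \<A> \<nu> f \<longleftrightarrow>
    (\<forall>\<epsilon>>0. \<exists>\<Gamma>. countable_partition T \<A> \<Gamma> \<and>
      (\<forall>A\<in>\<Gamma>. \<nu> A > 0 \<longrightarrow> bounded (f ` A)) \<and>
      (\<forall>t. (\<forall>A\<in>\<Gamma>. t A \<in> A) \<longrightarrow> (\<lambda>A. \<nu> A *\<^sub>R f (t A)) summable_on \<Gamma>) \<and>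
      (let S = {infsum (\<lambda>A. \<nu> A *\<^sub>R f (t A)) \<Gamma> | t. \<forall>A\<in>\<Gamma>. t A \<in> A}
       in bounded S \<and> diameter S < \<epsilon>))"

text \<open>On a compact space all continuous functions are bounded, so the type of bounded continuous
  functions with its norm is the space of continuous functions with the sup norm.\<close>

definition radstroem_embedding ::
    "('x::banach set \<Rightarrow> ('w::t2_space \<Rightarrow>\<^sub>C real)) \<Rightarrow> bool" where
  "radstroem_embedding j \<longleftrightarrow> compact (UNIV :: 'w set) \<and>
    (\<forall>A\<in>cwk. \<forall>C\<in>cwk. \<forall>\<alpha>\<ge>0. \<forall>\<beta>\<ge>0.
      j ((\<lambda>x. \<alpha> *\<^sub>R x) ` A + (\<lambda>x. \<beta> *\<^sub>R x) ` C) = \<alpha> *\<^sub>R j A + \<beta> *\<^sub>R j C) \<and>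
    (\<forall>A\<in>cwk. \<forall>C\<in>cwk. hausdorff_distance A C = ereal (norm (j A - j C)))"

definition birkhoff_integrable ::
    "('x::banach set \<Rightarrow> ('w::t2_space \<Rightarrow>\<^sub>C real)) \<Rightarrow>
      'a set \<Rightarrow> 'a set set \<Rightarrow> ('a set \<Rightarrow> real) \<Rightarrow> ('a \<Rightarrow> 'x set) \<Rightarrow> bool" where
  "birkhoff_integrable j T \<A> \<nu> F \<longleftrightarrow> birkhoff_integrable_fun T \<A> \<nu> (j \<circ> F)"

end

theory Submission
  imports Defs
begin

text \<open>By the Saks-Henstock lemma, the numbers \<open>\<bar>\<mu> A - \<Psi> A\<bar>\<close> have a small sum over every disjoint family
  that is finer than a suitable finite partition. As \<open>F\<close> is bounded, the Riemann sums for \<open>\<mu>\<close> and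
  for \<open>\<Psi>\<close> therefore have the same limits. As \<open>\<Psi>\<close> is countably additive, all but finitely many
  members of a countable partition have a negligible union, so that countable and finite partitions
  are interchangeable; this gives (i) \<open>\<longleftrightarrow>\<close> (iii) and (iii) \<open>\<longrightarrow>\<close> (ii). For (ii) \<open>\<longrightarrow>\<close> (iii), refining a
  partition replaces the values of \<open>j \<circ> F\<close> by averages, and passing to the convex hull does not
  increase the diameter of the set of sums. The limit sets belong to the right hyperspaces because
  closed sets are complete under the Hausdorff distance and weak compactness passes to Hausdorff
  limits, the latter by an argument of Grothendieck that rests on the Hahn-Banach theorem.\<close>

section \<open>Norming functionals\<close>

text \<open>Since \<open>\<mu>\<close> need not be additive, refining a partition can change its
  Riemann sums without control, whereas those for \<open>\<Psi>\<close> behave as for a measure. The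
  exchange of weights is also required on finite pieces cut out of countable partitions, so the
  Saks-Henstock bound is carried for partial families that do not cover \<open>T\<close>. Countable
  additivity of \<open>\<Psi>\<close> enters in the form that \<open>\<Psi> (T - B n)\<close>
  becomes small along an exhausting sequence \<open>B\<close>. Under (ii) the sums of the series
  live in the space of continuous functions, and no set is at hand as a candidate for the Gould
  integral. Hence only a Cauchy condition is drawn from (ii), carried back through the isometry
  \<open>j\<close>, and the limit set is built inside \<open>X\<close>. Hausdorff distances are
  extended reals; estimates mostly have the form
  \<open>hausdorff_distance A B \<le> ereal r\<close>, so that errors are added as real numbers. In
  each definition of \<open>\<delta>\<close> as \<open>\<epsilon>\<close> divided by
  \<open>c + d * M\<close>, the coefficients \<open>c\<close> and \<open>d\<close> count the errors
  of size \<open>\<delta>\<close> and \<open>M * \<delta>\<close>, with some room where a strict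
  inequality is wanted.\<close>

definition sublinear :: "('x::real_vector \<Rightarrow> real) \<Rightarrow> bool" where
  "sublinear p \<longleftrightarrow> (\<forall>x y. p (x + y) \<le> p x + p y) \<and> (\<forall>a x. 0 \<le> a \<longrightarrow> p (a *\<^sub>R x) = a * p x)"

lemma sublinear_add: "sublinear p \<Longrightarrow> p (x + y) \<le> p x + p y"
  and sublinear_scale: "sublinear p \<Longrightarrow> 0 \<le> a \<Longrightarrow> p (a *\<^sub>R x) = a * p x"
  by (auto simp: sublinear_def)

lemma sublinear_zero: "sublinear p \<Longrightarrow> p 0 = 0"
  using sublinear_scale[of p 0 0] by simp

lemma sublinear_ge_uminus: "sublinear p \<Longrightarrow> - p (- x) \<le> p x"
  using sublinear_add[of p x "- x"] sublinear_zero[of p] by simp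

text \<open>An upper estimate for positive factors suffices: applied to the factor
  \<open>1/a\<close> at \<open>a *\<^sub>R x\<close>, it becomes the reverse inequality.\<close>

lemma sublinearI:
  assumes add: "\<And>x y. q (x + y) \<le> q x + q y" and zero: "q 0 = 0"
    and scale: "\<And>a x. 0 < a \<Longrightarrow> q (a *\<^sub>R x) \<le> a * q x"
  shows "sublinear q"
  unfolding sublinear_def
proof (intro conjI allI impI)
  fix a :: real and x assume "0 \<le> a"
  show "q (a *\<^sub>R x) = a * q x"
  proof (cases "a = 0")
    case False
    with \<open>0 \<le> a\<close> have "0 < a" by simp
    have "q ((1/a) *\<^sub>R (a *\<^sub>R x)) \<le> (1/a) * q (a *\<^sub>R x)"
      using \<open>0 < a\<close> by (intro scale) simp
    then have "a * q x \<le> q (a *\<^sub>R x)"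
      using \<open>0 < a\<close> by (simp add: field_simps)
    with scale[OF \<open>0 < a\<close>, of x] show ?thesis by simp
  qed (simp add: zero)
qed (rule add)

text \<open>The largest sublinear functional below \<open>p\<close> that takes a value at most \<open>- p x\<close> at \<open>- x\<close>.\<close>

definition sublinear_reduct :: "('x::real_vector \<Rightarrow> real) \<Rightarrow> 'x \<Rightarrow> 'x \<Rightarrow> real" where
  "sublinear_reduct p x y = (INF t\<in>{0..}. p (y + t *\<^sub>R x) - t * p x)"

context
  fixes p :: "'x::real_vector \<Rightarrow> real" and x :: 'x
  assumes p: "sublinear p"
begin

lemma sublinear_reduct_bdd: "bdd_below ((\<lambda>t. p (y + t *\<^sub>R x) - t * p x) ` {0..})"
proof (rule bdd_belowI2[where m = "- p (- y)"])
  fix t :: real assume "t \<in> {0..}"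
  then show "- p (- y) \<le> p (y + t *\<^sub>R x) - t * p x"
    using sublinear_add[OF p, of "y + t *\<^sub>R x" "- y"] sublinear_scale[OF p, of t x] by simp
qed

lemma sublinear_reduct_le: "0 \<le> t \<Longrightarrow> sublinear_reduct p x y \<le> p (y + t *\<^sub>R x) - t * p x"
  unfolding sublinear_reduct_def by (rule cINF_lower[OF sublinear_reduct_bdd]) simp

lemma sublinear_reduct_le_self: "sublinear_reduct p x \<le> p"
  using sublinear_reduct_le[of 0] by (auto simp: le_fun_def)

lemma sublinear_reduct_uminus: "sublinear_reduct p x (- x) \<le> - p x"
  using sublinear_reduct_le[of 1 "- x"] sublinear_zero[OF p] by simp

lemma le_sublinear_reduct:
  "(\<And>t. 0 \<le> t \<Longrightarrow> c \<le> p (y + t *\<^sub>R x) - t * p x) \<Longrightarrow> c \<le> sublinear_reduct p x y"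
  unfolding sublinear_reduct_def by (rule cINF_greatest) auto

lemma sublinear_sublinear_reduct: "sublinear (sublinear_reduct p x)"
proof (rule sublinearI)
  fix y z
  \<comment> \<open>Parameters \<open>s\<close> for \<open>y\<close> and \<open>t\<close> for
    \<open>z\<close> combine into \<open>s + t\<close> for \<open>y + z\<close>. The two infima are
    then taken one after the other, with the remaining terms moved to the left.\<close>
  have "sublinear_reduct p x (y + z) - (p (z + t *\<^sub>R x) - t * p x) \<le> sublinear_reduct p x y"
    if t: "0 \<le> t" for t
  proof (rule le_sublinear_reduct)
    fix s :: real assume s: "0 \<le> s"
    show "sublinear_reduct p x (y + z) - (p (z + t *\<^sub>R x) - t * p x) \<le> p (y + s *\<^sub>R x) - s * p x"
      using sublinear_reduct_le[of "s + t" "y + z"] s t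
        sublinear_add[OF p, of "y + s *\<^sub>R x" "z + t *\<^sub>R x"]
      by (simp add: algebra_simps)
  qed
  then have "sublinear_reduct p x (y + z) - sublinear_reduct p x y \<le> sublinear_reduct p x z"
    by (intro le_sublinear_reduct) (auto simp: algebra_simps)
  then show "sublinear_reduct p x (y + z) \<le> sublinear_reduct p x y + sublinear_reduct p x z"
    by simp
next
  have "0 \<le> sublinear_reduct p x 0"
    by (rule le_sublinear_reduct) (simp add: sublinear_scale[OF p])
  then show "sublinear_reduct p x 0 = 0"
    using sublinear_reduct_le[of 0 0] sublinear_zero[OF p] by simp
next
  fix a :: real and y assume a: "0 < a"
  have "sublinear_reduct p x (a *\<^sub>R y) / a \<le> sublinear_reduct p x y"
  proof (rule le_sublinear_reduct)
    fix t :: real assume t: "0 \<le> t"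
    have "p (a *\<^sub>R y + (a * t) *\<^sub>R x) = a * p (y + t *\<^sub>R x)"
      using sublinear_scale[OF p, of a "y + t *\<^sub>R x"] a by (simp add: algebra_simps)
    then have "sublinear_reduct p x (a *\<^sub>R y) \<le> a * (p (y + t *\<^sub>R x) - t * p x)"
      using sublinear_reduct_le[of "a * t" "a *\<^sub>R y"] a t by (simp add: algebra_simps)
    then show "sublinear_reduct p x (a *\<^sub>R y) / a \<le> p (y + t *\<^sub>R x) - t * p x"
      using a by (simp add: field_simps)
  qed
  then show "sublinear_reduct p x (a *\<^sub>R y) \<le> a * sublinear_reduct p x y"
    using a by (simp add: field_simps)
qed

end

text \<open>Minimality makes every reduct of \<open>p\<close> equal to \<open>p\<close>; the
  parameter 1 in the infimum then gives \<open>p y + p x \<le> p (y + x)\<close>, the inequality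
  opposite to subadditivity.\<close>

lemma minimal_sublinear_linear:
  assumes p: "sublinear p" and min: "\<And>q. sublinear q \<Longrightarrow> q \<le> p \<Longrightarrow> q = p"
  shows "linear p"
proof -
  have "sublinear_reduct p x = p" for x
    by (rule min[OF sublinear_sublinear_reduct[OF p] sublinear_reduct_le_self[OF p]])
  then have "p y \<le> p (y + x) - p x" for x y
    using sublinear_reduct_le[OF p, of 1 x y] by simp
  then have add: "p (y + x) = p y + p x" for x y
    using sublinear_add[OF p, of y x] by (simp add: algebra_simps antisym)
  have minus: "p (- x) = - p x" for x
    using add[of x "- x"] sublinear_zero[OF p] by simp
  have "p (a *\<^sub>R x) = a * p x" for a x
    using sublinear_scale[OF p, of a x] sublinear_scale[OF p, of "- a" x] minus[of "a *\<^sub>R x"]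
    by (cases "0 \<le> a") auto
  with add show ?thesis by (intro linearI) auto
qed

text \<open>Hahn-Banach theorem without extension from subspaces: Zorn's lemma for the reversed
  order yields a minimal sublinear functional below \<open>p0\<close>, and such a functional is
  linear. The pointwise infimum of a nonempty chain is its lower bound.\<close>

lemma exists_linear_le_sublinear:
  assumes p0: "sublinear p0"
  obtains f where "linear f" "\<And>x. f x \<le> p0 x"
proof -
  define \<Q> where "\<Q> = {q. sublinear q \<and> q \<le> p0}"
  have "\<exists>m\<in>\<Q>. \<forall>q\<in>\<Q>. q \<le> m \<longrightarrow> q = m"
  proof (rule predicate_Zorn)
    show "partial_order_on \<Q> (relation_of (\<lambda>p q. q \<le> p) \<Q>)"
      by (auto simp: partial_order_on_def preorder_on_def refl_on_def trans_def antisym_def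
          relation_of_def)
  next
    fix C assume C: "C \<in> Chains (relation_of (\<lambda>p q. q \<le> p) \<Q>)"
    show "\<exists>u\<in>\<Q>. \<forall>q\<in>C. u \<le> q"
    proof (cases "C = {}")
      case True
      then show ?thesis using p0 by (auto simp: \<Q>_def)
    next
      case False
      have sub: "sublinear q" "q \<le> p0" if "q \<in> C" for q
        using C that by (auto simp: Chains_def relation_of_def \<Q>_def)
      have bdd: "bdd_below ((\<lambda>q. q y) ` C)" for y
      proof (rule bdd_belowI2[where m = "- p0 (- y)"])
        fix q assume "q \<in> C"
        from sublinear_ge_uminus[OF sub(1)[OF this], of y] sub(2)[OF this]
        show "- p0 (- y) \<le> q y" by (force simp: le_fun_def dest: spec[of _ "- y"])
      qed
      define u where "u y = (INF q\<in>C. q y)" for y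
      have u_le: "u y \<le> q y" if "q \<in> C" for q y
        unfolding u_def by (rule cINF_lower[OF bdd that])
      have le_u: "c \<le> u y" if "\<And>q. q \<in> C \<Longrightarrow> c \<le> q y" for c y
        unfolding u_def using False that by (rule cINF_greatest)
      have "sublinear u"
      proof (rule sublinearI)
        fix y z
        \<comment> \<open>Subadditivity of the infimum has to cope with two different members of the
          chain; the smaller of them serves for both.\<close>
        have key: "u (y + z) \<le> q y + r z" if qr: "q \<in> C" "r \<in> C" for q r
        proof -
          from C qr have "q \<le> r \<or> r \<le> q"
            by (auto simp: Chains_def relation_of_def)
          then have "\<exists>w\<in>C. w \<le> q \<and> w \<le> r"
            using qr by (elim disjE) (blast intro: order_refl)+
          then obtain w where "w \<in> C" "w \<le> q" "w \<le> r"
            by blast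
          then have "w y \<le> q y" "w z \<le> r z"
            by (auto simp: le_fun_def)
          then show ?thesis
            using u_le[OF \<open>w \<in> C\<close>, of "y + z"] sublinear_add[OF sub(1)[OF \<open>w \<in> C\<close>], of y z] by linarith
        qed
        have "u (y + z) - r z \<le> u y" if "r \<in> C" for r
          using key[OF _ that] by (intro le_u) (simp add: algebra_simps)
        then have "u (y + z) - u y \<le> u z"
          by (intro le_u) (simp add: algebra_simps)
        then show "u (y + z) \<le> u y + u z" by simp
      next
        show "u 0 = 0"
          using False sub(1) by (simp add: u_def sublinear_zero cong: INF_cong_simp)
      next
        fix a :: real and y assume a: "0 < a"
        have "u (a *\<^sub>R y) / a \<le> u y"
        proof (rule le_u)
          fix q assume "q \<in> C"
          then have "u (a *\<^sub>R y) \<le> a * q y"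
            using u_le[of q "a *\<^sub>R y"] sublinear_scale[OF sub(1), of q a y] a by simp
          then show "u (a *\<^sub>R y) / a \<le> q y"
            using a by (simp add: field_simps)
        qed
        then show "u (a *\<^sub>R y) \<le> a * u y"
          using a by (simp add: field_simps)
      qed
      moreover have "u \<le> p0"
      proof -
        obtain q where "q \<in> C" using False by blast
        then have "u \<le> q" using u_le by (auto simp: le_fun_def)
        with sub(2)[OF \<open>q \<in> C\<close>] show ?thesis by (rule order_trans[rotated])
      qed
      ultimately show ?thesis
        using u_le by (auto simp: \<Q>_def le_fun_def)
    qed
  qed
  then obtain m where m: "sublinear m" "m \<le> p0" "\<And>q. sublinear q \<Longrightarrow> q \<le> p0 \<Longrightarrow> q \<le> m \<Longrightarrow> q = m"
    by (auto simp: \<Q>_def)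
  have "linear m"
    using m by (intro minimal_sublinear_linear) (auto intro: order_trans)
  then show thesis
    using m(2) by (intro that[of m]) (auto simp: le_fun_def)
qed

text \<open>The functional is taken below the reduct of the norm at \<open>x\<close>, not merely
  below the norm: the reduct is at most \<open>- norm x\<close> at \<open>- x\<close>, which forces
  the value at \<open>x\<close> up to \<open>norm x\<close>.\<close>

lemma exists_norming_functional:
  fixes x :: "'x::real_normed_vector"
  obtains f :: "'x \<Rightarrow>\<^sub>L real" where "norm f \<le> 1" "blinfun_apply f x = norm x"
proof -
  have n: "sublinear (norm :: 'x \<Rightarrow> real)"
    by (auto simp: sublinear_def norm_triangle_ineq)
  obtain g where g: "linear g" "\<And>y. g y \<le> sublinear_reduct norm x y"
    using exists_linear_le_sublinear[OF sublinear_sublinear_reduct[OF n]] by blast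
  have le: "g y \<le> norm y" for y
    using g(2)[of y] sublinear_reduct_le_self[OF n, of x] by (auto simp: le_fun_def intro: order_trans)
  have "\<bar>g y\<bar> \<le> norm y" for y
    using le[of y] le[of "- y"] linear_neg[OF g(1), of y] by simp
  then have bl: "bounded_linear g"
    using g(1) by (intro bounded_linear_intro[where K = 1]) (auto simp: linear_add linear_scale)
  have "norm x \<le> g x"
    using g(2)[of "- x"] sublinear_reduct_uminus[OF n, of x] linear_neg[OF g(1), of x] by simp
  then have "g x = norm x" using le[of x] by simp
  moreover have "norm (Blinfun g) \<le> 1"
    using \<open>\<And>y. \<bar>g y\<bar> \<le> norm y\<close>
    by (intro norm_blinfun_bound) (auto simp: bounded_linear_Blinfun_apply[OF bl])
  ultimately show thesis
    using that[of "Blinfun g"] by (simp add: bounded_linear_Blinfun_apply[OF bl])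
qed

text \<open>Weak arguments give estimates functional by functional; a norming functional turns them
  into an estimate of the norm.\<close>

lemma norm_le_dual:
  fixes x :: "'x::real_normed_vector"
  assumes "\<And>f :: 'x \<Rightarrow>\<^sub>L real. \<bar>blinfun_apply f x\<bar> \<le> c * norm f" and "0 \<le> c"
  shows "norm x \<le> c"
proof -
  obtain f :: "'x \<Rightarrow>\<^sub>L real" where "norm f \<le> 1" "blinfun_apply f x = norm x"
    by (rule exists_norming_functional)
  with assms(1)[of f] mult_left_mono[of "norm f" 1 c] assms(2) show ?thesis by simp
qed

section \<open>The Hausdorff distance\<close>

lemma ereal_eqI_le:
  fixes x y :: ereal
  assumes "\<And>r. x \<le> ereal r \<longleftrightarrow> y \<le> ereal r"
  shows "x = y"
proof (rule antisym)
  show "x \<le> y" by (rule ereal_le_real) (rule assms[THEN iffD2])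
  show "y \<le> x" by (rule ereal_le_real) (rule assms[THEN iffD1])
qed

text \<open>The infimum over \<open>B\<close> need not be attained, so a bound \<open>r\<close>
  provides points only at distances below each \<open>s > r\<close>.\<close>

lemma excess_le_iff:
  "excess A B \<le> ereal r \<longleftrightarrow> (\<forall>x\<in>A. \<forall>s>r. \<exists>y\<in>B. norm (x - y) < s)"
proof -
  have "(INF y\<in>B. ereal (norm (x - y))) \<le> ereal r \<longleftrightarrow> (\<forall>s>r. \<exists>y\<in>B. norm (x - y) < s)" for x
  proof
    assume le: "(INF y\<in>B. ereal (norm (x - y))) \<le> ereal r"
    show "\<forall>s>r. \<exists>y\<in>B. norm (x - y) < s"
    proof (intro allI impI)
      fix s assume "r < s"
      with le have "(INF y\<in>B. ereal (norm (x - y))) < ereal s"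
        by (simp add: le_less_trans)
      then show "\<exists>y\<in>B. norm (x - y) < s"
        by (simp add: INF_less_iff)
    qed
  next
    assume *: "\<forall>s>r. \<exists>y\<in>B. norm (x - y) < s"
    show "(INF y\<in>B. ereal (norm (x - y))) \<le> ereal r"
    proof (rule ereal_le_epsilon2)
      fix e :: real assume "0 < e"
      with * obtain y where "y \<in> B" "norm (x - y) < r + e"
        by (meson less_add_same_cancel1)
      then show "(INF y\<in>B. ereal (norm (x - y))) \<le> ereal r + ereal e"
        by (intro INF_lower2[of y]) auto
    qed
  qed
  then show ?thesis
    by (simp add: excess_def SUP_le_iff)
qed

lemma hausdorff_distance_le_iff:
  "hausdorff_distance A B \<le> ereal r \<longleftrightarrow>
    (\<forall>x\<in>A. \<forall>s>r. \<exists>y\<in>B. norm (x - y) < s) \<and> (\<forall>y\<in>B. \<forall>s>r. \<exists>x\<in>A. norm (x - y) < s)"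
  by (simp add: hausdorff_distance_def excess_le_iff norm_minus_commute)

lemma hausdorff_distance_leD:
  assumes "hausdorff_distance A B \<le> ereal r" "r < s"
  shows "x \<in> A \<Longrightarrow> \<exists>y\<in>B. norm (x - y) < s" and "y \<in> B \<Longrightarrow> \<exists>x\<in>A. norm (x - y) < s"
  using assms by (auto simp: hausdorff_distance_le_iff)

lemma hausdorff_distance_leI:
  assumes "\<And>x. x \<in> A \<Longrightarrow> \<exists>y\<in>B. norm (x - y) \<le> r" and "\<And>y. y \<in> B \<Longrightarrow> \<exists>x\<in>A. norm (x - y) \<le> r"
  shows "hausdorff_distance A B \<le> ereal r"
  unfolding hausdorff_distance_le_iff
proof (intro conjI ballI allI impI)
  fix x s assume "x \<in> A" "r < s"
  then show "\<exists>y\<in>B. norm (x - y) < s" using assms(1)[of x] by force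
next
  fix y s assume "y \<in> B" "r < s"
  then show "\<exists>x\<in>A. norm (x - y) < s" using assms(2)[of y] by force
qed

lemma hausdorff_distance_commute: "hausdorff_distance A B = hausdorff_distance B A"
  by (simp add: hausdorff_distance_def max.commute)

text \<open>Real upper bounds replace a sum of extended reals. The slack \<open>u - r - s\<close> is
  shared equally between the two approximations.\<close>

lemma excess_triangle:
  assumes "excess A B \<le> ereal r" "excess B C \<le> ereal s"
  shows "excess A C \<le> ereal (r + s)"
  unfolding excess_le_iff
proof (intro ballI allI impI)
  fix x u assume x: "x \<in> A" and u: "r + s < u"
  define d where "d = (u - r - s) / 2"
  have d: "0 < d" using u by (simp add: d_def)
  obtain y where y: "y \<in> B" "norm (x - y) < r + d"
    using assms(1) x d unfolding excess_le_iff by (meson less_add_same_cancel1)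
  obtain z where z: "z \<in> C" "norm (y - z) < s + d"
    using assms(2) y d unfolding excess_le_iff by (meson less_add_same_cancel1)
  have "norm (x - z) \<le> norm (x - y) + norm (y - z)"
    using norm_triangle_ineq[of "x - y" "y - z"] by simp
  also have "\<dots> < u" using y z by (simp add: d_def field_simps)
  finally show "\<exists>z\<in>C. norm (x - z) < u" using z by blast
qed

lemma hausdorff_distance_triangle:
  assumes "hausdorff_distance A B \<le> ereal r" "hausdorff_distance B C \<le> ereal s"
  shows "hausdorff_distance A C \<le> ereal (r + s)"
  using assms excess_triangle[of A B r C s] excess_triangle[of C B s A r]
  by (simp add: hausdorff_distance_def add.commute)

lemma excess_closure_left: "excess (closure A) B = excess A B"
proof (rule ereal_eqI_le, rule iffI)
  fix r assume *: "excess A B \<le> ereal r"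
  show "excess (closure A) B \<le> ereal r"
  proof -
    have "excess (closure A) A \<le> ereal 0"
      by (auto simp: excess_le_iff closure_approachable dist_norm norm_minus_commute)
    from excess_triangle[OF this *] show ?thesis by simp
  qed
next
  fix r assume "excess (closure A) B \<le> ereal r"
  then show "excess A B \<le> ereal r"
    using closure_subset[of A] by (auto simp: excess_le_iff)
qed

lemma excess_closure_right: "excess A (closure B) = excess A B"
proof (rule ereal_eqI_le, rule iffI)
  fix r assume *: "excess A (closure B) \<le> ereal r"
  have "excess (closure B) B \<le> ereal 0"
    by (auto simp: excess_le_iff closure_approachable dist_norm norm_minus_commute)
  from excess_triangle[OF * this] show "excess A B \<le> ereal r" by simp
next
  fix r assume "excess A B \<le> ereal r"
  then show "excess A (closure B) \<le> ereal r"
    using closure_subset[of B] by (fastforce simp: excess_le_iff)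
qed

lemma hausdorff_distance_closure_left [simp]:
  "hausdorff_distance (closure A) B = hausdorff_distance A B"
  by (simp add: hausdorff_distance_def excess_closure_left excess_closure_right)

lemma hausdorff_distance_closure_right [simp]:
  "hausdorff_distance A (closure B) = hausdorff_distance A B"
  by (simp add: hausdorff_distance_def excess_closure_left excess_closure_right)

lemma excess_add:
  assumes "excess A B \<le> ereal r" "excess C D \<le> ereal s"
  shows "excess (A + C) (B + D) \<le> ereal (r + s)"
  unfolding excess_le_iff
proof (intro ballI allI impI)
  fix x u assume "x \<in> A + C" and u: "r + s < u"
  then obtain a c where ac: "x = a + c" "a \<in> A" "c \<in> C"
    by (auto elim: set_plus_elim)
  define d where "d = (u - r - s) / 2"
  have d: "0 < d" using u by (simp add: d_def)
  obtain b where b: "b \<in> B" "norm (a - b) < r + d"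
    using assms(1) ac d unfolding excess_le_iff by (meson less_add_same_cancel1)
  obtain e where e: "e \<in> D" "norm (c - e) < s + d"
    using assms(2) ac d unfolding excess_le_iff by (meson less_add_same_cancel1)
  have "norm (x - (b + e)) \<le> norm (a - b) + norm (c - e)"
    using norm_triangle_ineq[of "a - b" "c - e"] by (simp add: ac algebra_simps)
  also have "\<dots> < u" using b e by (simp add: d_def field_simps)
  finally show "\<exists>y\<in>B + D. norm (x - y) < u"
    using b e by (blast intro: set_plus_intro)
qed

lemma hausdorff_distance_add:
  assumes "hausdorff_distance A B \<le> ereal r" "hausdorff_distance C D \<le> ereal s"
  shows "hausdorff_distance (A + C) (B + D) \<le> ereal (r + s)"
  using assms excess_add[of A B r C D s] excess_add[of B A r D C s]
  by (simp add: hausdorff_distance_def)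

lemma hausdorff_distance_sum:
  assumes "\<And>i. i \<in> Q \<Longrightarrow> hausdorff_distance (A i) (B i) \<le> ereal (r i)"
  shows "hausdorff_distance (\<Sum>i\<in>Q. A i) (\<Sum>i\<in>Q. B i) \<le> ereal (\<Sum>i\<in>Q. r i)"
  using assms
proof (induction Q rule: infinite_finite_induct)
  case (insert x Q)
  then show ?case by (simp add: hausdorff_distance_add)
\<comment> \<open>Over an infinite index set both sums take the default value \<open>0\<close>,
  which is the set \<open>{0}\<close>, exactly as in the empty case.\<close>
qed (auto intro!: hausdorff_distance_leI)

lemma hausdorff_distance_scaleR:
  assumes "\<And>x. x \<in> K \<Longrightarrow> norm x \<le> M"
  shows "hausdorff_distance ((\<lambda>x. a *\<^sub>R x) ` K) ((\<lambda>x. b *\<^sub>R x) ` K) \<le> ereal (M * \<bar>a - b\<bar>)"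
proof -
  have "norm (a *\<^sub>R x - b *\<^sub>R x) \<le> M * \<bar>a - b\<bar>" if "x \<in> K" for x
    using assms[OF that] by (simp flip: scaleR_diff_left add: mult.commute mult_right_mono)
  then show ?thesis by (intro hausdorff_distance_leI) auto
qed

lemma bounded_hausdorff_distance:
  assumes "bounded A" "hausdorff_distance A B \<le> ereal r"
  shows "bounded B"
proof -
  obtain b where b: "\<And>x. x \<in> A \<Longrightarrow> norm x \<le> b"
    using assms(1) by (auto simp: bounded_iff)
  have "norm y \<le> b + (r + 1)" if y: "y \<in> B" for y
  proof -
    obtain x where "x \<in> A" "norm (x - y) < r + 1"
      using hausdorff_distance_leD(2)[OF assms(2) _ y, of "r + 1"] by auto
    with b[of x] norm_triangle_ineq4[of x "x - y"] show ?thesis by simp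
  qed
  then show ?thesis by (auto simp: bounded_iff)
qed

text \<open>The distances of consecutive points chosen from consecutive sets are below \<open>2 / 2 ^ n\<close>, and
  these bounds add up to \<open>4 / 2 ^ n\<close>.\<close>

lemma hausdorff_distance_limit:
  fixes S :: "nat \<Rightarrow> 'x::banach set"
  assumes ne: "\<And>n. S n \<noteq> {}" and S: "\<And>n. hausdorff_distance (S n) (S (Suc n)) \<le> ereal (1 / 2 ^ n)"
  obtains K where "closed K" "K \<noteq> {}" "\<And>n. hausdorff_distance (S n) K \<le> ereal (4 / 2 ^ n)"
proof -
  \<comment> \<open>Requiring the final error bound against every \<open>S n\<close> makes
    \<open>K\<close> closed and gives one half of the distance estimate at once; the other half is
    \<open>forth\<close>.\<close>
  define K where "K = (\<Inter>n. {x. infdist x (S n) \<le> 4 / 2 ^ n})"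
  have less: "(1::real) / 2 ^ n < 2 / 2 ^ n" for n
    by (simp add: divide_strict_right_mono)
  have closed: "closed K"
    unfolding K_def by (intro closed_INT ballI closed_Collect_le continuous_intros)
  \<comment> \<open>The subtracted term is kept because it is precisely the room used up later, when
    a point of \<open>S n\<close> is replaced by a limit point at distance at most
    \<open>4 / 2 ^ n\<close>.\<close>
  have earlier: "infdist x (S m) \<le> 4 / 2 ^ m - 4 / 2 ^ (m + k)" if "x \<in> S (m + k)" for x m k
    using that
  proof (induction k arbitrary: x)
    case (Suc k)
    then obtain x' where x': "x' \<in> S (m + k)" "norm (x' - x) < 2 / 2 ^ (m + k)"
      using hausdorff_distance_leD(2)[OF S less, of x "m + k"] by auto
    have "infdist x (S m) \<le> infdist x' (S m) + dist x x'"
      by (rule infdist_triangle)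
    also have "\<dots> \<le> (4 / 2 ^ m - 4 / 2 ^ (m + k)) + 2 / 2 ^ (m + k)"
      using Suc.IH[OF x'(1)] x'(2) by (simp add: dist_norm norm_minus_commute)
    also have "\<dots> = 4 / 2 ^ m - 4 / 2 ^ (m + Suc k)"
      by (simp add: field_simps)
    finally show ?case .
  qed simp
  have forth: "\<exists>y\<in>K. norm (x - y) \<le> 4 / 2 ^ n" if x: "x \<in> S n" for x n
  proof -
    \<comment> \<open>Dependent choice of a sequence through \<open>S n\<close>,
      \<open>S (n + 1)\<close> and so on, starting at \<open>x\<close>. Its limit will be the
      required point of \<open>K\<close>.\<close>
    have "\<exists>c. \<forall>i. (c i \<in> S (n + i) \<and> (i = 0 \<longrightarrow> c i = x)) \<and> norm (c i - c (Suc i)) < 2 / 2 ^ (n + i)"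
    proof (rule dependent_nat_choice)
      fix z i assume "z \<in> S (n + i) \<and> (i = 0 \<longrightarrow> z = x)"
      then show "\<exists>y. (y \<in> S (n + Suc i) \<and> (Suc i = 0 \<longrightarrow> y = x)) \<and> norm (z - y) < 2 / 2 ^ (n + i)"
        using hausdorff_distance_leD(1)[OF S less, of z "n + i"] by auto
    qed (use x in auto)
    then obtain c where c: "\<And>i. c i \<in> S (n + i)" "c 0 = x"
      and step: "\<And>i. norm (c i - c (Suc i)) < 2 / 2 ^ (n + i)" by blast
    have dist: "dist (c i) (c (i + k)) \<le> 4 / 2 ^ (n + i) - 4 / 2 ^ (n + i + k)" for i k
    proof (induction k)
      case (Suc k)
      have "dist (c i) (c (i + Suc k)) \<le> dist (c i) (c (i + k)) + dist (c (i + k)) (c (Suc (i + k)))"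
        using dist_triangle by simp
      also have "\<dots> \<le> (4 / 2 ^ (n + i) - 4 / 2 ^ (n + i + k)) + 2 / 2 ^ (n + (i + k))"
        using Suc.IH step[of "i + k"] by (intro add_mono) (simp_all add: dist_norm)
      also have "\<dots> = 4 / 2 ^ (n + i) - 4 / 2 ^ (n + i + Suc k)"
        by (simp add: field_simps)
      finally show ?case .
    qed simp
    have dist_le: "dist (c i) (c (i + k)) \<le> 4 / 2 ^ (n + i)" for i k
    proof -
      have "(0::real) \<le> 4 / 2 ^ (n + i + k)" by simp
      with dist[of i k] show ?thesis by linarith
    qed
    have lim: "(\<lambda>i. 4 / 2 ^ (n + i) :: real) \<longlonglongrightarrow> 0"
    proof -
      have "(\<lambda>i. (4 / 2 ^ n) * (1 / 2) ^ i :: real) \<longlonglongrightarrow> (4 / 2 ^ n) * 0"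
        by (intro tendsto_intros LIMSEQ_realpow_zero) auto
      then show ?thesis by (simp add: power_add power_divide)
    qed
    have "Cauchy c"
      unfolding Cauchy_altdef
    proof (intro allI impI)
      fix e :: real assume "0 < e"
      with lim have "\<forall>\<^sub>F i in sequentially. 4 / 2 ^ (n + i) < e"
        by (rule order_tendstoD)
      then obtain N where N: "\<And>i. N \<le> i \<Longrightarrow> 4 / 2 ^ (n + i) < e"
        by (auto simp: eventually_sequentially)
      have "dist (c i) (c k) < e" if "N \<le> i" "i < k" for i k
        using dist_le[of i "k - i"] N[OF that(1)] that(2) by simp
      then show "\<exists>M. \<forall>m\<ge>M. \<forall>n>m. dist (c m) (c n) < e" by blast
    qed
    then obtain y where y: "c \<longlonglongrightarrow> y"
      using Cauchy_convergent_iff convergent_def by blast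
    have dist_y: "dist (c i) y \<le> 4 / 2 ^ (n + i)" for i
    proof (rule LIMSEQ_le_const2)
      show "(\<lambda>k. dist (c i) (c k)) \<longlonglongrightarrow> dist (c i) y"
        by (intro tendsto_intros y)
      have "dist (c i) (c k) \<le> 4 / 2 ^ (n + i)" if "i \<le> k" for k
        using dist_le[of i "k - i"] that by simp
      then show "\<exists>N. \<forall>k\<ge>N. dist (c i) (c k) \<le> 4 / 2 ^ (n + i)" by blast
    qed
    have "infdist y (S m) \<le> 4 / 2 ^ m" for m
    proof (cases "n \<le> m")
      case True
      then show ?thesis
        using infdist_le[OF c(1), of y "m - n"] dist_y[of "m - n"] by (simp add: dist_commute)
    next
      case False
      then have "infdist x (S m) \<le> 4 / 2 ^ m - 4 / 2 ^ n"
        using earlier[of x m "n - m"] x by simp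
      moreover have "infdist y (S m) \<le> infdist x (S m) + dist y x"
        by (rule infdist_triangle)
      ultimately show ?thesis
        using dist_y[of 0] c(2) by (simp add: dist_commute)
    qed
    then have "y \<in> K" by (simp add: K_def)
    with dist_y[of 0] c(2) show ?thesis by (auto simp: dist_norm)
  qed
  have "hausdorff_distance (S n) K \<le> ereal (4 / 2 ^ n)" for n
    unfolding hausdorff_distance_le_iff
  proof (intro conjI ballI allI impI)
    fix x s assume "x \<in> S n" "4 / 2 ^ n < (s::real)"
    then show "\<exists>y\<in>K. norm (x - y) < s"
      using forth[of x n] by force
  next
    fix y s assume "y \<in> K" "4 / 2 ^ n < (s::real)"
    moreover from this have "infdist y (S n) \<le> 4 / 2 ^ n"
      by (simp add: K_def)
    ultimately have "(INF x\<in>S n. dist y x) < s"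
      using ne by (simp add: infdist_notempty)
    then show "\<exists>x\<in>S n. norm (x - y) < s"
      using ne by (subst (asm) cINF_less_iff) (auto simp: dist_norm norm_minus_commute intro: bdd_belowI2[of _ 0])
  qed
  moreover have "K \<noteq> {}"
    using forth ne by blast
  ultimately show thesis
    using closed that by blast
qed

section \<open>Weakly compact sets\<close>

lemma compactin_pullback_topology:
  "compactin (pullback_topology A f X) K \<longleftrightarrow> K \<subseteq> A \<and> compactin X (f ` K)"
proof (intro iffI conjI)
  assume K: "compactin (pullback_topology A f X) K"
  then show "K \<subseteq> A"
    by (auto simp: compactin_def topspace_pullback_topology)
  have "continuous_map (pullback_topology A f X) X (id \<circ> f)"
    by (rule continuous_map_pullback) (rule continuous_map_id)
  with K show "compactin X (f ` K)"
    by (auto intro: image_compactin)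
next
  assume "K \<subseteq> A \<and> compactin X (f ` K)"
  then have KA: "K \<subseteq> A" and K: "compactin X (f ` K)" by auto
  show "compactin (pullback_topology A f X) K"
    unfolding compactin_def
  proof (intro conjI allI impI)
    show "K \<subseteq> topspace (pullback_topology A f X)"
      using KA K by (auto simp: compactin_def topspace_pullback_topology)
  next
    fix \<U> assume \<U>: "Ball \<U> (openin (pullback_topology A f X)) \<and> K \<subseteq> \<Union>\<U>"
    then have "\<forall>U\<in>\<U>. \<exists>V. openin X V \<and> U = f -` V \<inter> A"
      by (auto simp: openin_pullback_topology)
    then obtain V where V: "\<And>U. U \<in> \<U> \<Longrightarrow> openin X (V U)" "\<And>U. U \<in> \<U> \<Longrightarrow> U = f -` V U \<inter> A"
      by metis
    have "f ` K \<subseteq> \<Union>(V ` \<U>)"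
      using \<U> V(2) by blast
    moreover have "Ball (V ` \<U>) (openin X)" using V(1) by blast
    ultimately obtain \<F> where "finite \<F>" "\<F> \<subseteq> V ` \<U>" "f ` K \<subseteq> \<Union>\<F>"
      using K unfolding compactin_def by meson
    then obtain \<G> where \<G>: "\<G> \<subseteq> \<U>" "finite \<G>" "f ` K \<subseteq> \<Union>(V ` \<G>)"
      by (metis finite_subset_image)
    have "K \<subseteq> \<Union>\<G>"
    proof
      fix x assume "x \<in> K"
      with \<G>(3) obtain U where "U \<in> \<G>" "f x \<in> V U" by blast
      with V(2)[of U] \<G>(1) KA \<open>x \<in> K\<close> show "x \<in> \<Union>\<G>" by blast
    qed
    with \<G> show "\<exists>\<F>. finite \<F> \<and> \<F> \<subseteq> \<U> \<and> K \<subseteq> \<Union>\<F>" by blast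
  qed
qed

text \<open>The canonical embedding into the bidual, with values taken as bare functions on the dual
  space. Their type carries the topology of pointwise convergence, so that weak compactness becomes
  compactness of an image and Tychonoff's theorem applies.\<close>

definition bidual_map :: "'x::real_normed_vector \<Rightarrow> ('x \<Rightarrow>\<^sub>L real) \<Rightarrow> real" where
  "bidual_map x f = blinfun_apply f x"

lemma cwk_iff: "A \<in> cwk \<longleftrightarrow> A \<noteq> {} \<and> convex A \<and> compact (bidual_map ` A)"
proof -
  have "bidual_map = (\<lambda>(x::'a) f. blinfun_apply f x)"
    by (intro ext) (simp add: bidual_map_def)
  then show ?thesis
    by (simp add: cwk_def weak_topology_def compactin_pullback_topology)
qed

lemma compact_fun_closed:
  fixes S :: "('i \<Rightarrow> 'b::metric_space) set"
  assumes "compact S"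
  shows "closed S"
proof -
  have "Hausdorff_space (euclidean :: ('i \<Rightarrow> 'b) topology)"
    unfolding euclidean_product_topology[symmetric] Hausdorff_space_product_topology
    by (simp add: Hausdorff_space_euclidean)
  with assms show ?thesis
    using compactin_imp_closedin[of euclidean S] by simp
qed

lemma compact_pointwise_add:
  fixes S R :: "('i \<Rightarrow> real) set"
  assumes "compact S" "compact R"
  shows "compact ((\<lambda>(u, v) i. u i + v i) ` (S \<times> R))"
proof (rule compact_continuous_image)
  show "compact (S \<times> R)" using assms by (rule compact_Times)
  have 1: "continuous_on (S \<times> R) (\<lambda>x. fst x i)" for i
    by (rule continuous_on_product_then_coordinatewise[OF continuous_on_fst[OF continuous_on_id]])
  have 2: "continuous_on (S \<times> R) (\<lambda>x. snd x i)" for i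
    by (rule continuous_on_product_then_coordinatewise[OF continuous_on_snd[OF continuous_on_id]])
  show "continuous_on (S \<times> R) (\<lambda>(u, v) i. u i + v i)"
    unfolding case_prod_beta
    by (intro continuous_on_coordinatewise_then_product continuous_on_add 1 2)
qed

lemma compact_pointwise_scale:
  fixes S :: "('i \<Rightarrow> real) set"
  assumes "compact S"
  shows "compact ((\<lambda>u i. a * u i) ` S)"
proof (rule compact_continuous_image[OF _ assms])
  have "continuous_on S (\<lambda>x. x i)" for i
    by (rule continuous_on_product_then_coordinatewise[OF continuous_on_id])
  then show "continuous_on S (\<lambda>u i. a * u i)"
    by (intro continuous_on_coordinatewise_then_product continuous_on_mult_left)
qed

text \<open>A product of compact intervals, by Tychonoff. With \<open>r f = e * norm f\<close> it
  takes the place of the Banach-Alaoglu theorem.\<close>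

lemma compact_pointwise_bounded: "compact {u :: 'i \<Rightarrow> real. \<forall>i. \<bar>u i\<bar> \<le> r i}"
proof -
  have "{u :: 'i \<Rightarrow> real. \<forall>i. \<bar>u i\<bar> \<le> r i} = (\<Pi>\<^sub>E i\<in>UNIV. {- r i..r i})"
    by (auto simp: abs_le_iff PiE_def Pi_def minus_le_iff)
  moreover have "compactin (product_topology (\<lambda>i. euclidean) UNIV) (\<Pi>\<^sub>E i\<in>UNIV. {- r i..r i})"
    by (simp add: compactin_PiE)
  ultimately show ?thesis
    by (simp add: euclidean_product_topology)
qed

lemma cwk_add: "A \<in> cwk \<Longrightarrow> B \<in> cwk \<Longrightarrow> A + B \<in> cwk"
proof -
  assume A: "A \<in> cwk" and B: "B \<in> cwk"
  have "bidual_map ` (A + B) = (\<lambda>(u, v) f. u f + v f) ` (bidual_map ` A \<times> bidual_map ` B)"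
    by (force simp: set_plus_def bidual_map_def fun_eq_iff blinfun.add_right)
  with A B show ?thesis
    by (auto simp: cwk_iff convex_set_plus set_plus_intro intro!: compact_pointwise_add)
qed

lemma cwk_scaleR: "A \<in> cwk \<Longrightarrow> (\<lambda>x. a *\<^sub>R x) ` A \<in> cwk"
proof -
  assume A: "A \<in> cwk"
  have "bidual_map ` (\<lambda>x. a *\<^sub>R x) ` A = (\<lambda>u f. a * u f) ` bidual_map ` A"
    by (auto simp: image_image bidual_map_def fun_eq_iff blinfun.scaleR_right intro!: image_cong)
  with A show ?thesis
    by (auto simp: cwk_iff convex_scaling intro!: compact_pointwise_scale)
qed

lemma cwk_sum: "(\<And>i. i \<in> Q \<Longrightarrow> A i \<in> cwk) \<Longrightarrow> (\<Sum>i\<in>Q. A i) \<in> cwk"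
proof (induction Q rule: infinite_finite_induct)
  case (insert x Q)
  then show ?case by (simp add: cwk_add)
qed (auto simp: cwk_iff)

text \<open>Two points of \<open>K\<close> are moved into a convex set \<open>S\<close> nearby,
  combined there, and the combination is moved back; the errors do not grow, as the coefficients add
  up to 1.\<close>

lemma convex_closed_limit:
  assumes "closed K" and approx: "\<And>e. 0 < e \<Longrightarrow> \<exists>S. convex S \<and> hausdorff_distance S K \<le> ereal e"
  shows "convex K"
proof (rule convexI)
  fix x y and u v :: real
  assume xy: "x \<in> K" "y \<in> K" and uv: "0 \<le> u" "0 \<le> v" "u + v = 1"
  have "u *\<^sub>R x + v *\<^sub>R y \<in> closure K"
    unfolding closure_approachable
  proof (intro allI impI)
    fix e :: real assume "0 < e"
    then obtain S where S: "convex S" "hausdorff_distance S K \<le> ereal (e/3)"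
      using approx[of "e/3"] by auto
    have "e/3 < e/2" using \<open>0 < e\<close> by simp
    note near = hausdorff_distance_leD[OF S(2) this]
    obtain x' where x': "x' \<in> S" "norm (x' - x) < e/2"
      using near(2)[OF xy(1)] by blast
    obtain y' where y': "y' \<in> S" "norm (y' - y) < e/2"
      using near(2)[OF xy(2)] by blast
    have "u *\<^sub>R x' + v *\<^sub>R y' \<in> S"
      using S(1) x' y' uv by (auto dest: convexD)
    then obtain z where z: "z \<in> K" "norm (u *\<^sub>R x' + v *\<^sub>R y' - z) < e/2"
      using near(1) by blast
    have "norm (u *\<^sub>R (x' - x) + v *\<^sub>R (y' - y)) \<le> u * norm (x' - x) + v * norm (y' - y)"
      using uv norm_triangle_ineq[of "u *\<^sub>R (x' - x)" "v *\<^sub>R (y' - y)"] by simp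
    also have "\<dots> \<le> e/2"
      using x' y' uv by (intro convex_bound_le) auto
    finally have "norm (u *\<^sub>R x' + v *\<^sub>R y' - (u *\<^sub>R x + v *\<^sub>R y)) \<le> e/2"
      by (simp add: algebra_simps)
    then have "dist z (u *\<^sub>R x + v *\<^sub>R y) < e"
      using z(2) dist_triangle[of z "u *\<^sub>R x + v *\<^sub>R y" "u *\<^sub>R x' + v *\<^sub>R y'"]
      by (simp add: dist_norm norm_minus_commute[of z])
    with z(1) show "\<exists>z\<in>K. dist z (u *\<^sub>R x + v *\<^sub>R y) < e" by blast
  qed
  with \<open>closed K\<close> show "u *\<^sub>R x + v *\<^sub>R y \<in> K" by simp
qed

text \<open>The weak closure of \<open>K\<close> in the bidual lies in each set \<open>S + e B\<close>, where \<open>S\<close> is weakly compact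
  and \<open>B\<close> is the bidual ball. Each of its points is therefore a norm limit of points of \<open>X\<close>, and it
  belongs to \<open>K\<close> as \<open>K\<close> is norm closed.\<close>

lemma cwk_limit:
  fixes K :: "'x::banach set"
  assumes K: "closed K" "K \<noteq> {}"
    and approx: "\<And>e. 0 < e \<Longrightarrow> \<exists>S\<in>cwk. hausdorff_distance S K \<le> ereal e"
  shows "K \<in> cwk"
proof -
  \<comment> \<open>All functions dominated by \<open>e * norm f\<close>, linear or not. This set
    contains the bidual ball of radius \<open>e\<close> and is compact as a product of
    intervals.\<close>
  define D where "D e = {\<eta> :: ('x \<Rightarrow>\<^sub>L real) \<Rightarrow> real. \<forall>f. \<bar>\<eta> f\<bar> \<le> e * norm f}" for e
  define C where "C S e = (\<lambda>(u, v) f. u f + v f) ` (bidual_map ` S \<times> D e)" for S e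
  have compact_C: "compact (C S e)" if "S \<in> cwk" for S e
    unfolding C_def D_def using that
    by (intro compact_pointwise_add compact_pointwise_bounded) (simp add: cwk_iff)
  \<comment> \<open>The distance bound is \<open>e/2\<close> because it yields neighbours only at
    distances below a larger number, here \<open>e\<close>.\<close>
  have sub_C: "bidual_map ` K \<subseteq> C S e" if S: "hausdorff_distance S K \<le> ereal (e/2)" and e: "0 < e" for S e
  proof
    fix \<xi> assume "\<xi> \<in> bidual_map ` K"
    then obtain y where y: "y \<in> K" "\<xi> = bidual_map y" by blast
    have half_less: "e/2 < e" using e by simp
    obtain x where x: "x \<in> S" "norm (x - y) < e"
      using hausdorff_distance_leD(2)[OF S half_less y(1)] by blast
    have "bidual_map (y - x) \<in> D e"
    proof -
      have "\<bar>blinfun_apply f (y - x)\<bar> \<le> e * norm f" for f :: "'x \<Rightarrow>\<^sub>L real"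
        using norm_blinfun[of f "y - x"] x(2) mult_left_mono[of "norm (y - x)" e "norm f"]
        by (simp add: norm_minus_commute mult.commute)
      then show ?thesis by (simp add: D_def bidual_map_def)
    qed
    moreover have "\<xi> = (\<lambda>f. bidual_map x f + bidual_map (y - x) f)"
      by (simp add: y bidual_map_def fun_eq_iff blinfun.diff_right)
    ultimately show "\<xi> \<in> C S e"
      using x(1) unfolding C_def by (intro image_eqI[where x = "(bidual_map x, bidual_map (y - x))"]) auto
  qed
  \<comment> \<open>The closure stays inside the closed set \<open>C S e\<close>. One error
    \<open>e\<close> is the component in \<open>D e\<close>, the other comes from replacing the
    point of \<open>S\<close> by a point of \<open>K\<close>.\<close>
  have near: "\<exists>y\<in>K. \<forall>f. \<bar>\<xi> f - blinfun_apply f y\<bar> \<le> 2 * e * norm f"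
    if \<xi>: "\<xi> \<in> closure (bidual_map ` K)" and e: "0 < e" for \<xi> e
  proof -
    obtain S where S: "S \<in> cwk" "hausdorff_distance S K \<le> ereal (e/2)"
      using approx[of "e/2"] e by auto
    have "\<xi> \<in> C S e"
      using \<xi> closure_minimal[OF sub_C[OF S(2) e] compact_fun_closed[OF compact_C[OF S(1)]]] by blast
    then obtain x \<eta> where x: "x \<in> S" "\<eta> \<in> D e" "\<And>f. \<xi> f = blinfun_apply f x + \<eta> f"
      by (auto simp: C_def bidual_map_def)
    have half_less: "e/2 < e" using e by simp
    obtain y where y: "y \<in> K" "norm (x - y) < e"
      using hausdorff_distance_leD(1)[OF S(2) half_less x(1)] by blast
    have "\<bar>\<xi> f - blinfun_apply f y\<bar> \<le> 2 * e * norm f" for f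
    proof -
      have "\<bar>\<xi> f - blinfun_apply f y\<bar> \<le> \<bar>blinfun_apply f (x - y)\<bar> + \<bar>\<eta> f\<bar>"
        by (simp add: x(3) blinfun.diff_right)
      also have "\<dots> \<le> norm f * e + e * norm f"
        using norm_blinfun[of f "x - y"] y(2) mult_left_mono[of "norm (x - y)" e "norm f"] x(2)
        by (intro add_mono) (auto simp: D_def)
      finally show ?thesis by simp
    qed
    with y(1) show ?thesis by blast
  qed
  have "closure (bidual_map ` K) \<subseteq> bidual_map ` K"
  proof
    fix \<xi> assume \<xi>: "\<xi> \<in> closure (bidual_map ` K)"
    have "\<exists>y\<in>K. \<forall>f. \<bar>\<xi> f - blinfun_apply f y\<bar> \<le> 2 * inverse (real (Suc n)) * norm f" for n
      by (rule near[OF \<xi>]) simp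
    then obtain y where y: "\<And>n. y n \<in> K"
      and \<xi>y: "\<And>n f. \<bar>\<xi> f - blinfun_apply f (y n)\<bar> \<le> 2 * inverse (real (Suc n)) * norm f"
      by metis
    \<comment> \<open>Both points approximate the same \<open>\<xi>\<close>, uniformly on the dual
      unit ball. This makes \<open>y\<close> a Cauchy sequence in norm, and completeness of the
      space gives a limit that represents \<open>\<xi>\<close>.\<close>
    have dist: "norm (y m - y n) \<le> 2 * inverse (real (Suc m)) + 2 * inverse (real (Suc n))" for m n
    proof (rule norm_le_dual)
      fix f :: "'x \<Rightarrow>\<^sub>L real"
      show "\<bar>blinfun_apply f (y m - y n)\<bar>
          \<le> (2 * inverse (real (Suc m)) + 2 * inverse (real (Suc n))) * norm f"
        using \<xi>y[of f m] \<xi>y[of f n] unfolding distrib_right blinfun.diff_right by linarith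
    qed (intro add_nonneg_nonneg; simp)
    have "Cauchy y"
    proof (rule CauchyI)
      fix e :: real assume "0 < e"
      then obtain N where N: "inverse (real (Suc N)) < e/4"
        using reals_Archimedean[of "e/4"] by auto
      have "norm (y m - y n) < e" if "N \<le> m" "N \<le> n" for m n
      proof -
        have "inverse (real (Suc m)) \<le> inverse (real (Suc N))" "inverse (real (Suc n)) \<le> inverse (real (Suc N))"
          using that by (auto intro!: le_imp_inverse_le)
        with N dist[of m n] show ?thesis by linarith
      qed
      then show "\<exists>M. \<forall>m\<ge>M. \<forall>n\<ge>M. norm (y m - y n) < e" by blast
    qed
    then obtain z where z: "y \<longlonglongrightarrow> z"
      using Cauchy_convergent_iff convergent_def by blast
    have "z \<in> K"
      using closed_sequentially[OF K(1)] y z by blast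
    have "\<xi> f = blinfun_apply f z" for f
    proof -
      have "(\<lambda>n. 2 * inverse (real (Suc n)) * norm f) \<longlonglongrightarrow> 2 * 0 * norm f"
        by (intro tendsto_intros LIMSEQ_inverse_real_of_nat)
      then have lim: "(\<lambda>n. 2 * inverse (real (Suc n)) * norm f) \<longlonglongrightarrow> 0" by simp
      have "(\<lambda>n. \<xi> f - blinfun_apply f (y n)) \<longlonglongrightarrow> 0"
        by (rule Lim_null_comparison[OF always_eventually lim]) (simp only: real_norm_def \<xi>y simp_thms)
      then have "(\<lambda>n. \<xi> f - (\<xi> f - blinfun_apply f (y n))) \<longlonglongrightarrow> \<xi> f - 0"
        by (intro tendsto_intros)
      then have "(\<lambda>n. blinfun_apply f (y n)) \<longlonglongrightarrow> \<xi> f" by simp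
      moreover have "(\<lambda>n. blinfun_apply f (y n)) \<longlonglongrightarrow> blinfun_apply f z"
        by (intro tendsto_intros z)
      ultimately show ?thesis by (rule LIMSEQ_unique)
    qed
    then show "\<xi> \<in> bidual_map ` K"
      using \<open>z \<in> K\<close> by (intro image_eqI[of _ _ z]) (auto simp: bidual_map_def fun_eq_iff)
  qed
  then have closed: "closed (bidual_map ` K)"
    using closure_subset_eq by blast
  obtain S where S: "S \<in> cwk" "hausdorff_distance S K \<le> ereal (1/2)"
    using approx[of "1/2"] by auto
  \<comment> \<open>A closed image is compact as soon as it lies in some compact set; the
    approximation with \<open>e = 1\<close> supplies one.\<close>
  have "compact (bidual_map ` K \<inter> C S 1)"
    using closed compact_C[OF S(1)] by (rule closed_Int_compact)
  then have "compact (bidual_map ` K)"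
    using sub_C[OF S(2)] by (simp add: Int_absorb2)
  moreover have "convex K"
    using K(1)
  proof (rule convex_closed_limit)
    fix e :: real assume "0 < e"
    then show "\<exists>S. convex S \<and> hausdorff_distance S K \<le> ereal e"
      using approx[of e] by (auto simp: cwk_iff)
  qed
  ultimately show ?thesis
    using K(2) by (simp add: cwk_iff)
qed

section \<open>Finite partitions ordered by refinement\<close>

lemma Union_remove_empty [simp]: "\<Union>(S - {{}}) = \<Union>S"
  by blast

definition partition_meet :: "'a set set \<Rightarrow> 'a set set \<Rightarrow> 'a set set" where
  "partition_meet P Q = (\<lambda>(A, B). A \<inter> B) ` (P \<times> Q) - {{}}"

lemma partition_on_meet:
  assumes P: "partition_on T P" and Q: "partition_on T Q"
  shows "partition_on T (partition_meet P Q)"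
proof (rule partition_onI)
  show "\<Union>(partition_meet P Q) = T"
  proof (intro equalityI subsetI)
    fix x assume "x \<in> T"
    then obtain A B where "A \<in> P" "x \<in> A" "B \<in> Q" "x \<in> B"
      using P Q unfolding partition_on_def by blast
    then show "x \<in> \<Union>(partition_meet P Q)"
      unfolding partition_meet_def by (intro UnionI[of "A \<inter> B"]) auto
  qed (use P in \<open>auto simp: partition_meet_def partition_on_def\<close>)
next
  fix X Y assume XY: "X \<in> partition_meet P Q" "Y \<in> partition_meet P Q" "X \<noteq> Y"
  then obtain A B A' B' where "X = A \<inter> B" "Y = A' \<inter> B'" "A \<in> P" "A' \<in> P" "B \<in> Q" "B' \<in> Q"
    by (auto simp: partition_meet_def)
  moreover from this XY(3) have "A \<inter> A' = {} \<or> B \<inter> B' = {}"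
    using P Q unfolding partition_on_def disjoint_def by metis
  ultimately show "disjnt X Y"
    by (auto simp: disjnt_def)
qed (auto simp: partition_meet_def)

lemma refines_meet:
  assumes "partition_on T P" "partition_on T Q"
  shows "refines T (partition_meet P Q) P" and "refines T (partition_meet P Q) Q"
  using assms partition_on_meet[OF assms] by (auto simp: refines_def partition_meet_def)

text \<open>A member of \<open>P\<close> that already fits into a member of \<open>Q\<close>
  survives the meet uncut, so it can keep its tag. The refinement assumption supplies that
  \<open>A\<close> is nonempty.\<close>

lemma refines_meet_mono:
  assumes "refines T P P'" "A \<in> P" "A \<subseteq> B" "B \<in> Q"
  shows "A \<in> partition_meet P Q"
proof -
  have "A = A \<inter> B" "A \<noteq> {}"
    using assms by (auto simp: refines_def partition_on_def)
  with assms show ?thesis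
    unfolding partition_meet_def by blast
qed

text \<open>Shrinking disjoint sets can identify two of them only by making both empty, and the
  empty set contributes nothing.\<close>

lemma sum_disjoint_image:
  fixes m :: "'a set \<Rightarrow> 'b::comm_monoid_add"
  assumes "finite P" "disjoint P" "\<And>C. C \<in> P \<Longrightarrow> g C \<subseteq> C" "m {} = 0"
  shows "(\<Sum>D\<in>g ` P - {{}}. m D) = (\<Sum>C\<in>P. m (g C))"
proof -
  have "(\<Sum>D\<in>g ` P - {{}}. m D) = (\<Sum>D\<in>g ` P. m D)"
    using assms by (intro sum.mono_neutral_left) auto
  also have "\<dots> = (\<Sum>C\<in>P. m (g C))"
  proof (rule sum.reindex_nontrivial[unfolded comp_def])
    fix x y assume xy: "x \<in> P" "y \<in> P" "x \<noteq> y" "g x = g y"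
    then have "g x \<subseteq> x \<inter> y" using assms(3) by blast
    also have "x \<inter> y = {}" using xy assms(2) by (auto simp: disjoint_def)
    finally show "m (g x) = 0"
      using assms(4) by simp
  qed fact
  finally show ?thesis .
qed

text \<open>The net of finite partitions is encoded as a filter, so that its limits are instances of
  \<open>tendsto\<close> and obey the usual rules for sums, order and uniqueness.\<close>

definition partition_filter :: "'a set \<Rightarrow> 'a set set \<Rightarrow> 'a set set filter" where
  "partition_filter T \<A> =
    (INF P0\<in>{P. finite_partition T \<A> P}. principal {P. finite_partition T \<A> P \<and> refines T P P0})"

text \<open>Partial partitions finer than \<open>P\<close>: nothing forces them to cover the space.
  The Saks-Henstock lemma speaks of these families.\<close>

definition subordinate_family :: "'a set set \<Rightarrow> 'a set set \<Rightarrow> 'a set set \<Rightarrow> bool" where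
  "subordinate_family \<A> P Q \<longleftrightarrow>
    finite Q \<and> disjoint Q \<and> {} \<notin> Q \<and> Q \<subseteq> \<A> \<and> (\<forall>A\<in>Q. \<exists>B\<in>P. A \<subseteq> B)"

definition partition_completion :: "'a set set \<Rightarrow> 'a set set \<Rightarrow> 'a set set" where
  "partition_completion Q P = Q \<union> ((\<lambda>C. C - \<Union>Q) ` P - {{}})"

section \<open>Measurable partitions and their refinement filter\<close>

context sigma_algebra
begin

lemma finite_partition_meet:
  assumes "finite_partition \<Omega> M P" "finite_partition \<Omega> M Q"
  shows "finite_partition \<Omega> M (partition_meet P Q)"
proof -
  have "partition_meet P Q \<subseteq> M"
    using assms by (auto simp: partition_meet_def finite_partition_def)
  with assms show ?thesis
    using partition_on_meet[of \<Omega> P Q] by (simp add: finite_partition_def) (simp add: partition_meet_def)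
qed

lemma countable_partition_meet:
  assumes "countable_partition \<Omega> M P" "countable_partition \<Omega> M Q"
  shows "countable_partition \<Omega> M (partition_meet P Q)"
proof -
  have "partition_meet P Q \<subseteq> M"
    using assms by (auto simp: partition_meet_def countable_partition_def)
  with assms show ?thesis
    using partition_on_meet[of \<Omega> P Q] by (simp add: countable_partition_def) (simp add: partition_meet_def)
qed

lemma finite_imp_countable_partition:
  "finite_partition \<Omega> M P \<Longrightarrow> countable_partition \<Omega> M P"
  by (auto simp: finite_partition_def countable_partition_def countable_finite)

text \<open>Removing the empty set makes the trivial partition correct for an empty space as well,
  where it has no members.\<close>

lemma finite_partition_space: "finite_partition \<Omega> M ({\<Omega>} - {{}})"
  by (auto simp: finite_partition_def partition_on_def disjoint_def)

lemma eventually_partition_filter: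
  "eventually \<phi> (partition_filter \<Omega> M) \<longleftrightarrow>
    (\<exists>P0. finite_partition \<Omega> M P0 \<and> (\<forall>P. finite_partition \<Omega> M P \<and> refines \<Omega> P P0 \<longrightarrow> \<phi> P))"
  unfolding partition_filter_def
proof (subst eventually_INF_base)
  show "{P. finite_partition \<Omega> M P} \<noteq> {}"
    using finite_partition_space by blast
next
  fix P Q assume PQ: "P \<in> {P. finite_partition \<Omega> M P}" "Q \<in> {P. finite_partition \<Omega> M P}"
  then have "partition_on \<Omega> P" "partition_on \<Omega> Q"
    by (auto simp: finite_partition_def)
  from refines_meet[OF this] PQ
  show "\<exists>R\<in>{P. finite_partition \<Omega> M P}.
      principal {P. finite_partition \<Omega> M P \<and> refines \<Omega> P R}
        \<le> inf (principal {Pa. finite_partition \<Omega> M Pa \<and> refines \<Omega> Pa P})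
            (principal {P. finite_partition \<Omega> M P \<and> refines \<Omega> P Q})"
    by (intro bexI[of _ "partition_meet P Q"])
      (auto simp: finite_partition_meet intro: refines_trans)
qed (auto simp: eventually_principal)

lemma eventually_refines:
  "finite_partition \<Omega> M P0 \<Longrightarrow>
    eventually (\<lambda>P. finite_partition \<Omega> M P \<and> refines \<Omega> P P0) (partition_filter \<Omega> M)"
  by (auto simp: eventually_partition_filter)

lemma eventually_finite_partition:
  "eventually (finite_partition \<Omega> M) (partition_filter \<Omega> M)"
  using finite_partition_space by (auto simp: eventually_partition_filter)

lemma partition_filter_nontrivial [simp]: "partition_filter \<Omega> M \<noteq> bot"
  unfolding trivial_limit_def eventually_partition_filter
  by (auto simp: finite_partition_def dest: refines_refl)

lemma partition_limit_iff:
  "partition_limit \<Omega> M m L \<longleftrightarrow> ((\<lambda>P. \<Sum>A\<in>P. m A) \<longlongrightarrow> L) (partition_filter \<Omega> M)"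
  by (simp add: partition_limit_def tendsto_iff eventually_partition_filter dist_real_def)

text \<open>The sum formula separates a contribution of \<open>Q\<close> that stays fixed from one
  that varies with \<open>P\<close>. Convergence on subsets and the Saks-Henstock lemma both rest on
  this separation.\<close>

lemma partition_completion:
  assumes Q: "subordinate_family M P0 Q"
    and P: "finite_partition \<Omega> M P" "refines \<Omega> P P0"
  shows "finite_partition \<Omega> M (partition_completion Q P)"
    and "refines \<Omega> (partition_completion Q P) P0"
    and "m {} = 0 \<Longrightarrow> (\<Sum>A\<in>partition_completion Q P. m A :: 'b::comm_monoid_add)
           = (\<Sum>A\<in>Q. m A) + (\<Sum>C\<in>P. m (C - \<Union>Q))"
proof -
  have QM: "Q \<subseteq> M" "finite Q" "disjoint Q" "{} \<notin> Q"
    using Q by (auto simp: subordinate_family_def)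
  have PM: "P \<subseteq> M" "finite P" "disjoint P" "\<Union>P = \<Omega>"
    using P by (auto simp: finite_partition_def partition_on_def)
  have "\<Union>Q \<in> M" using QM by (auto intro: finite_Union)
  have po: "partition_on \<Omega> (partition_completion Q P)"
  proof (rule partition_onI)
    have "\<Union>((\<lambda>C. C - \<Union>Q) ` P) = \<Omega> - \<Union>Q"
      using PM(4) by blast
    then show "\<Union>(partition_completion Q P) = \<Omega>"
      using sets_into_space[OF \<open>\<Union>Q \<in> M\<close>]
      unfolding partition_completion_def Union_Un_distrib Union_remove_empty by (simp add: Un_absorb1)
  next
    show "disjnt X Y" if "X \<in> partition_completion Q P" "Y \<in> partition_completion Q P" "X \<noteq> Y" for X Y
    proof -
      have "X \<in> Q \<or> (\<exists>C\<in>P. X = C - \<Union>Q)" "Y \<in> Q \<or> (\<exists>C\<in>P. Y = C - \<Union>Q)"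
        using that by (auto simp: partition_completion_def)
      then consider "X \<in> Q" "Y \<in> Q" | C where "X \<in> Q" "Y = C - \<Union>Q" | C where "Y \<in> Q" "X = C - \<Union>Q"
        | C D where "C \<in> P" "D \<in> P" "X = C - \<Union>Q" "Y = D - \<Union>Q"
        by blast
      then show ?thesis
      proof cases
        case 1
        then show ?thesis using disjointD[OF QM(3)] that(3) by (simp add: disjnt_def)
      next
        case (4 C D)
        then have "C \<inter> D = {}" using disjointD[OF PM(3)] that(3) by blast
        then show ?thesis using 4 by (auto simp: disjnt_def)
      qed (auto simp: disjnt_def)
    qed
  qed (use QM in \<open>auto simp: partition_completion_def\<close>)
  moreover have "partition_completion Q P \<subseteq> M"
    using QM PM \<open>\<Union>Q \<in> M\<close> by (auto simp: partition_completion_def)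
  ultimately show "finite_partition \<Omega> M (partition_completion Q P)"
    using QM PM by (auto simp: finite_partition_def partition_completion_def)
  have "\<exists>B\<in>P0. C - \<Union>Q \<subseteq> B" if C: "C \<in> P" for C
  proof -
    obtain B where "B \<in> P0" "C \<subseteq> B" using P(2) C by (auto simp: refines_def)
    then show ?thesis by (intro bexI[of _ B]) auto
  qed
  then show "refines \<Omega> (partition_completion Q P) P0"
    using Q P(2) po unfolding refines_def partition_completion_def subordinate_family_def by auto
  assume m: "m {} = 0"
  have "(\<Sum>A\<in>partition_completion Q P. m A)
      = (\<Sum>A\<in>Q. m A) + (\<Sum>D\<in>(\<lambda>C. C - \<Union>Q) ` P - {{}}. m D)"
    unfolding partition_completion_def using QM PM by (intro sum.union_disjoint) auto
  also have "(\<Sum>D\<in>(\<lambda>C. C - \<Union>Q) ` P - {{}}. m D) = (\<Sum>C\<in>P. m (C - \<Union>Q))"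
    using PM m by (intro sum_disjoint_image) auto
  finally show "(\<Sum>A\<in>partition_completion Q P. m A) = (\<Sum>A\<in>Q. m A) + (\<Sum>C\<in>P. m (C - \<Union>Q))" .
qed

end

section \<open>The integral function of an integrable set function\<close>

locale integrable_set_fun = sigma_algebra T \<A> for T :: "'a set" and \<A> +
  fixes \<mu> :: "'a set \<Rightarrow> real"
  assumes nonneg: "A \<in> \<A> \<Longrightarrow> 0 \<le> \<mu> A" and empty [simp]: "\<mu> {} = 0"
    and integrable: "integrable_set_function T \<A> \<mu>"
begin

abbreviation \<F> :: "'a set set filter" where "\<F> \<equiv> partition_filter T \<A>"

abbreviation \<Psi> :: "'a set \<Rightarrow> real" where "\<Psi> \<equiv> integral_function T \<A> \<mu>"

text \<open>A fixed partition of \<open>T - A\<close>, cut from \<open>P0\<close>, is completed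
  inside \<open>A\<close> by ever finer \<open>P\<close>. The sums over the completed partitions
  differ from the sums on \<open>A\<close> by a constant, so the latter inherit the Cauchy
  property.\<close>

lemma convergent_restriction:
  assumes A: "A \<in> \<A>"
  shows "\<exists>L. ((\<lambda>P. \<Sum>C\<in>P. \<mu> (A \<inter> C)) \<longlongrightarrow> L) \<F>"
proof -
  let ?s = "\<lambda>P. \<Sum>C\<in>P. \<mu> (A \<inter> C)"
  obtain L where L: "partition_limit T \<A> \<mu> L"
    using integrable by (auto simp: integrable_set_function_def)
  have "cauchy_filter (filtermap ?s \<F>)"
    unfolding cauchy_filter_metric_filtermap
  proof (intro allI impI)
    fix e :: real assume "0 < e"
    then obtain P0 where P0: "finite_partition T \<A> P0"
      "\<And>P. finite_partition T \<A> P \<Longrightarrow> refines T P P0 \<Longrightarrow> \<bar>(\<Sum>A\<in>P. \<mu> A) - L\<bar> < e/2"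
      using L unfolding partition_limit_def by (meson half_gt_zero)
    define Q where "Q = (\<lambda>B. B - A) ` P0 - {{}}"
    have P0': "P0 \<subseteq> \<A>" "finite P0" "disjoint P0" "\<Union>P0 = T"
      using P0(1) by (auto simp: finite_partition_def partition_on_def)
    have "disjoint Q"
      using P0'(3) unfolding Q_def disjoint_def by blast
    then have Q: "subordinate_family \<A> P0 Q"
      using P0' A unfolding subordinate_family_def Q_def by auto
    have UQ: "\<Union>Q = T - A"
      using P0' by (auto simp: Q_def)
    have approx: "\<bar>(\<Sum>A\<in>Q. \<mu> A) + ?s P - L\<bar> < e/2" if P: "finite_partition T \<A> P" "refines T P P0" for P
    proof -
      have "C - \<Union>Q = A \<inter> C" if "C \<in> P" for C
        using that P(1) unfolding UQ finite_partition_def partition_on_def by blast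
      then have "(\<Sum>A\<in>partition_completion Q P. \<mu> A) = (\<Sum>A\<in>Q. \<mu> A) + ?s P"
        using partition_completion(3)[OF Q P, of \<mu>] by simp
      with P0(2)[OF partition_completion(1,2)[OF Q P]] show ?thesis by simp
    qed
    have "dist (?s P) (?s P') < e"
      if "finite_partition T \<A> P \<and> refines T P P0" "finite_partition T \<A> P' \<and> refines T P' P0" for P P'
      using approx[of P] approx[of P'] that unfolding dist_real_def by linarith
    then show "\<exists>\<phi>. eventually \<phi> \<F> \<and> (\<forall>P P'. \<phi> P \<and> \<phi> P' \<longrightarrow> dist (?s P) (?s P') < e)"
      using eventually_refines[OF P0(1)] by blast
  qed
  then show ?thesis
    using complete_UNIV[where 'a = real] unfolding complete_uniform filterlim_def
    by (auto simp: filtermap_bot_iff)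
qed

lemma tendsto_integral_function:
  assumes "A \<in> \<A>"
  shows "((\<lambda>P. \<Sum>C\<in>P. \<mu> (A \<inter> C)) \<longlongrightarrow> \<Psi> A) \<F>"
proof -
  obtain L where L: "((\<lambda>P. \<Sum>C\<in>P. \<mu> (A \<inter> C)) \<longlongrightarrow> L) \<F>"
    using convergent_restriction[OF assms] by blast
  then have "\<Psi> A = L"
    unfolding integral_function_def partition_limit_iff
    by (intro the_equality) (auto intro: tendsto_unique[OF partition_filter_nontrivial])
  with L show ?thesis by simp
qed

lemma integral_function_nonneg: "A \<in> \<A> \<Longrightarrow> 0 \<le> \<Psi> A"
proof (rule tendsto_lowerbound[OF tendsto_integral_function])
  assume A: "A \<in> \<A>"
  show "\<forall>\<^sub>F P in \<F>. 0 \<le> (\<Sum>C\<in>P. \<mu> (A \<inter> C))"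
    using eventually_finite_partition
    by eventually_elim (use A in \<open>auto simp: finite_partition_def intro!: sum_nonneg nonneg\<close>)
qed auto

lemma integral_function_empty [simp]: "\<Psi> {} = 0"
  using tendsto_integral_function[of "{}"] by (simp add: tendsto_const_iff)

text \<open>Additivity arises although \<open>\<mu>\<close> may lack it: each member of a partition
  finer than \<open>A\<close> and its complement lies in \<open>A\<close> or misses
  \<open>A\<close>, so at most one of its traces on \<open>A\<close> and \<open>B\<close> is
  nonempty.\<close>

lemma integral_function_Un:
  assumes A: "A \<in> \<A>" and B: "B \<in> \<A>" and disj: "A \<inter> B = {}"
  shows "\<Psi> (A \<union> B) = \<Psi> A + \<Psi> B"
proof (rule tendsto_unique[OF partition_filter_nontrivial])
  show "((\<lambda>P. \<Sum>C\<in>P. \<mu> ((A \<union> B) \<inter> C)) \<longlongrightarrow> \<Psi> (A \<union> B)) \<F>"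
    using A B by (intro tendsto_integral_function) auto
  have "\<Union>{A, T - A} = T" "disjoint {A, T - A}"
    using sets_into_space[OF A] by (auto simp: disjoint_def)
  then have "finite_partition T \<A> ({A, T - A} - {{}})"
    using A unfolding finite_partition_def partition_on_def
    by (auto simp del: Union_insert intro: pairwise_subset)
  then have "\<forall>\<^sub>F P in \<F>. finite_partition T \<A> P \<and> refines T P ({A, T - A} - {{}})"
    by (rule eventually_refines)
  then have "\<forall>\<^sub>F P in \<F>. (\<Sum>C\<in>P. \<mu> (A \<inter> C)) + (\<Sum>C\<in>P. \<mu> (B \<inter> C)) = (\<Sum>C\<in>P. \<mu> ((A \<union> B) \<inter> C))"
  proof eventually_elim
    case (elim P)
    have "\<mu> (A \<inter> C) + \<mu> (B \<inter> C) = \<mu> ((A \<union> B) \<inter> C)" if "C \<in> P" for C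
    proof -
      from elim that have "C \<subseteq> A \<or> C \<subseteq> T - A"
        by (auto simp: refines_def)
      then show ?thesis
      proof
        assume "C \<subseteq> A"
        then have "B \<inter> C = {}" "(A \<union> B) \<inter> C = A \<inter> C" using disj by auto
        then show ?thesis by simp
      next
        assume "C \<subseteq> T - A"
        then have "A \<inter> C = {}" "(A \<union> B) \<inter> C = B \<inter> C" by auto
        then show ?thesis by simp
      qed
    qed
    then show ?case by (simp flip: sum.distrib)
  qed
  then show "((\<lambda>P. \<Sum>C\<in>P. \<mu> ((A \<union> B) \<inter> C)) \<longlongrightarrow> \<Psi> A + \<Psi> B) \<F>"
    using tendsto_add[OF tendsto_integral_function[OF A] tendsto_integral_function[OF B]]
    by (rule Lim_transform_eventually[rotated])
qed

lemma integral_function_Diff: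
  assumes "A \<in> \<A>" "B \<in> \<A>" "A \<subseteq> B"
  shows "\<Psi> (B - A) = \<Psi> B - \<Psi> A"
  using integral_function_Un[of A "B - A"] assms Diff[of B A] by (simp add: Un_absorb1)

lemma integral_function_mono:
  assumes "A \<in> \<A>" "B \<in> \<A>" "A \<subseteq> B"
  shows "\<Psi> A \<le> \<Psi> B"
  using integral_function_Diff[OF assms] integral_function_nonneg[of "B - A"] assms Diff[of B A] by simp

lemma integral_function_Union:
  assumes "finite Q" "disjoint Q" "Q \<subseteq> \<A>"
  shows "\<Psi> (\<Union>Q) = (\<Sum>A\<in>Q. \<Psi> A)"
  using assms
proof (induction Q rule: finite_induct)
  case (insert A Q)
  then have "A \<inter> \<Union>Q = {}"
    by (auto simp: disjoint_def)
  then have "\<Psi> (A \<union> \<Union>Q) = \<Psi> A + \<Psi> (\<Union>Q)"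
    using insert by (intro integral_function_Un) auto
  with insert show ?case
    by (simp add: pairwise_insert)
qed simp

definition henstock_fine :: "real \<Rightarrow> 'a set set \<Rightarrow> bool" where
  "henstock_fine \<delta> P \<longleftrightarrow> finite_partition T \<A> P \<and>
    (\<forall>Q. subordinate_family \<A> P Q \<longrightarrow> (\<Sum>A\<in>Q. \<bar>\<mu> A - \<Psi> A\<bar>) \<le> \<delta>)"

lemma henstock_fine_partition: "henstock_fine \<delta> P \<Longrightarrow> finite_partition T \<A> P"
  by (simp add: henstock_fine_def)

text \<open>Saks-Henstock lemma: completing \<open>Q\<close> to a partition and letting the part of it outside \<open>\<Union>Q\<close>
  become finer and finer shows that the errors on \<open>Q\<close> add up to at most \<open>\<epsilon>\<close>.\<close>

lemma henstock:
  assumes "0 < \<epsilon>"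
  obtains P where "henstock_fine \<epsilon> P"
proof -
  have "T \<inter> C = C" if "finite_partition T \<A> P" "C \<in> P" for P C
    using that by (auto simp: finite_partition_def partition_on_def)
  then have "\<forall>\<^sub>F P in \<F>. (\<Sum>C\<in>P. \<mu> (T \<inter> C)) = (\<Sum>C\<in>P. \<mu> C)"
    using eventually_finite_partition by (auto elim!: eventually_mono intro!: sum.cong)
  with tendsto_integral_function[OF top] have "((\<lambda>P. \<Sum>C\<in>P. \<mu> C) \<longlongrightarrow> \<Psi> T) \<F>"
    by (rule Lim_transform_eventually)
  then obtain P0 where P0: "finite_partition T \<A> P0"
    "\<And>P. finite_partition T \<A> P \<Longrightarrow> refines T P P0 \<Longrightarrow> \<bar>(\<Sum>A\<in>P. \<mu> A) - \<Psi> T\<bar> < \<epsilon>/2"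
    using \<open>0 < \<epsilon>\<close> unfolding partition_limit_iff[symmetric] partition_limit_def by (meson half_gt_zero)
  have signed: "\<bar>\<Sum>A\<in>Q. \<mu> A - \<Psi> A\<bar> \<le> \<epsilon>/2" if Q: "subordinate_family \<A> P0 Q" for Q
  proof -
    have Q': "finite Q" "disjoint Q" "Q \<subseteq> \<A>"
      using Q by (auto simp: subordinate_family_def)
    then have UQ: "\<Union>Q \<in> \<A>" by (auto intro: finite_Union)
    let ?s = "\<lambda>P. \<Sum>C\<in>P. \<mu> ((T - \<Union>Q) \<inter> C)"
    have "\<forall>\<^sub>F P in \<F>. finite_partition T \<A> P \<and> refines T P P0"
      by (rule eventually_refines[OF P0(1)])
    then have "\<forall>\<^sub>F P in \<F>. \<bar>(\<Sum>A\<in>Q. \<mu> A) + ?s P - \<Psi> T\<bar> \<le> \<epsilon>/2"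
    proof eventually_elim
      case (elim P)
      then have P: "finite_partition T \<A> P" "refines T P P0" by auto
      have "C - \<Union>Q = (T - \<Union>Q) \<inter> C" if "C \<in> P" for C
        using that P(1) unfolding finite_partition_def partition_on_def by blast
      then have "(\<Sum>A\<in>partition_completion Q P. \<mu> A) = (\<Sum>A\<in>Q. \<mu> A) + ?s P"
        using partition_completion(3)[OF Q P, of \<mu>] by simp
      with P0(2)[OF partition_completion(1,2)[OF Q P]] show ?case by simp
    qed
    moreover have "((\<lambda>P. \<bar>(\<Sum>A\<in>Q. \<mu> A) + ?s P - \<Psi> T\<bar>) \<longlongrightarrow> \<bar>(\<Sum>A\<in>Q. \<mu> A) + \<Psi> (T - \<Union>Q) - \<Psi> T\<bar>) \<F>"
      using UQ by (intro tendsto_intros tendsto_integral_function) auto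
    ultimately have "\<bar>(\<Sum>A\<in>Q. \<mu> A) + \<Psi> (T - \<Union>Q) - \<Psi> T\<bar> \<le> \<epsilon>/2"
      by (intro tendsto_upperbound[OF _ _ partition_filter_nontrivial])
    then show ?thesis
      using integral_function_Diff[OF UQ top] sets_into_space[OF UQ] integral_function_Union[OF Q']
      by (simp add: sum_subtractf)
  qed
  have "(\<Sum>A\<in>Q. \<bar>\<mu> A - \<Psi> A\<bar>) \<le> \<epsilon>" if Q: "subordinate_family \<A> P0 Q" for Q
  proof -
    \<comment> \<open>The nonnegative and the negative errors belong to two subfamilies, each again
      subordinate to \<open>P0\<close>. Each contributes at most \<open>\<epsilon>/2\<close> by the
      signed estimate, without cancellation.\<close>
    define Q1 where "Q1 = {A\<in>Q. 0 \<le> \<mu> A - \<Psi> A}"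
    define Q2 where "Q2 = {A\<in>Q. \<not> 0 \<le> \<mu> A - \<Psi> A}"
    have "subordinate_family \<A> P0 Q1" "subordinate_family \<A> P0 Q2"
      using Q by (auto simp: subordinate_family_def Q1_def Q2_def disjoint_def)
    note signed[OF this(1)] signed[OF this(2)]
    moreover have "(\<Sum>A\<in>Q. \<bar>\<mu> A - \<Psi> A\<bar>) = (\<Sum>A\<in>Q1. \<bar>\<mu> A - \<Psi> A\<bar>) + (\<Sum>A\<in>Q2. \<bar>\<mu> A - \<Psi> A\<bar>)"
      using Q unfolding Q1_def Q2_def subordinate_family_def
      by (subst sum.union_disjoint[symmetric]) (auto intro: sum.cong)
    moreover have "(\<Sum>A\<in>Q1. \<bar>\<mu> A - \<Psi> A\<bar>) = (\<Sum>A\<in>Q1. \<mu> A - \<Psi> A)"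
      by (rule sum.cong) (auto simp: Q1_def)
    moreover have "(\<Sum>A\<in>Q2. \<bar>\<mu> A - \<Psi> A\<bar>) = - (\<Sum>A\<in>Q2. \<mu> A - \<Psi> A)"
      unfolding sum_negf[symmetric] by (rule sum.cong) (auto simp: Q2_def)
    ultimately show ?thesis by linarith
  qed
  with P0(1) show thesis
    by (intro that[of P0]) (simp add: henstock_fine_def)
qed

end

section \<open>Continuity from below and tails of countable partitions\<close>

locale continuous_integrable_set_fun = integrable_set_fun +
  assumes continuous_from_below:
    "range A \<subseteq> \<A> \<Longrightarrow> incseq A \<Longrightarrow> (\<lambda>n. \<mu> (A n)) \<longlonglongrightarrow> \<mu> (\<Union>n. A n)"
begin

text \<open>Continuity passes from \<open>\<mu>\<close> to \<open>\<Psi>\<close> because one finite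
  partition approximates \<open>\<Psi> D\<close> within \<open>\<epsilon>/4\<close> for all
  \<open>D\<close> simultaneously. Two such errors, at \<open>B n\<close> and at \<open>T\<close>,
  and one for the convergence of finitely many values of \<open>\<mu>\<close> stay below
  \<open>\<epsilon>\<close>.\<close>

lemma integral_function_exhaustion:
  fixes B :: "nat \<Rightarrow> 'a set"
  assumes B: "range B \<subseteq> \<A>" "incseq B" "(\<Union>n. B n) = T" and e: "0 < \<epsilon>"
  shows "\<exists>n. \<Psi> (T - B n) < \<epsilon>"
proof -
  obtain P0 where P0_fine: "henstock_fine (\<epsilon>/4) P0"
    using henstock[of "\<epsilon>/4"] e by auto
  then have P0: "finite_partition T \<A> P0"
    and hen: "\<And>Q. subordinate_family \<A> P0 Q \<Longrightarrow> (\<Sum>A\<in>Q. \<bar>\<mu> A - \<Psi> A\<bar>) \<le> \<epsilon>/4"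
    by (simp_all add: henstock_fine_def)
  have P0': "P0 \<subseteq> \<A>" "finite P0" "disjoint P0" "\<Union>P0 = T" "{} \<notin> P0"
    using P0(1) by (auto simp: finite_partition_def partition_on_def)
  \<comment> \<open>The nonempty traces of \<open>P0\<close> on \<open>D\<close> form a subordinate
    family with union \<open>D\<close>, which makes the bound uniform in \<open>D\<close>.\<close>
  have near: "\<bar>(\<Sum>C\<in>P0. \<mu> (C \<inter> D)) - \<Psi> D\<bar> \<le> \<epsilon>/4" if D: "D \<in> \<A>" for D
  proof -
    define Q where "Q = (\<lambda>C. C \<inter> D) ` P0 - {{}}"
    have "disjoint Q"
      using P0'(3) unfolding Q_def disjoint_def by blast
    then have Q: "subordinate_family \<A> P0 Q"
      using P0' D unfolding subordinate_family_def Q_def by auto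
    have UQ: "\<Union>Q = D"
      using P0'(4) sets_into_space[OF D] unfolding Q_def Union_remove_empty by blast
    have "(\<Sum>A\<in>Q. \<mu> A) = (\<Sum>C\<in>P0. \<mu> (C \<inter> D))"
      unfolding Q_def using P0' by (intro sum_disjoint_image) auto
    moreover have "(\<Sum>A\<in>Q. \<Psi> A) = \<Psi> D"
      using integral_function_Union[of Q] Q UQ by (simp add: subordinate_family_def)
    moreover have "\<bar>\<Sum>A\<in>Q. \<mu> A - \<Psi> A\<bar> \<le> \<epsilon>/4"
      using sum_abs hen[OF Q] by (rule order_trans)
    ultimately show ?thesis by (simp add: sum_subtractf)
  qed
  have "(\<lambda>n. \<mu> (C \<inter> B n)) \<longlonglongrightarrow> \<mu> C" if "C \<in> P0" for C
  proof -
    have "(\<Union>n. C \<inter> B n) = C" using B(3) P0'(4) that by blast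
    moreover have "(\<lambda>n. \<mu> (C \<inter> B n)) \<longlonglongrightarrow> \<mu> (\<Union>n. C \<inter> B n)"
      using B(1,2) that P0'(1) by (intro continuous_from_below) (auto simp: incseq_def intro!: Int)
    ultimately show ?thesis by simp
  qed
  then have "(\<lambda>n. \<Sum>C\<in>P0. \<mu> (C \<inter> B n)) \<longlonglongrightarrow> (\<Sum>C\<in>P0. \<mu> C)"
    by (intro tendsto_sum)
  moreover have "(\<Sum>C\<in>P0. \<mu> (C \<inter> T)) = (\<Sum>C\<in>P0. \<mu> C)"
    using P0'(1) sets_into_space by (intro sum.cong) (auto simp: Int_absorb2)
  ultimately have "(\<lambda>n. \<Sum>C\<in>P0. \<mu> (C \<inter> B n)) \<longlonglongrightarrow> (\<Sum>C\<in>P0. \<mu> (C \<inter> T))"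
    by simp
  from tendstoD[OF this, of "\<epsilon>/4"] e
  have "\<forall>\<^sub>F n in sequentially. dist (\<Sum>C\<in>P0. \<mu> (C \<inter> B n)) (\<Sum>C\<in>P0. \<mu> (C \<inter> T)) < \<epsilon>/4"
    by auto
  then obtain n where n: "dist (\<Sum>C\<in>P0. \<mu> (C \<inter> B n)) (\<Sum>C\<in>P0. \<mu> (C \<inter> T)) < \<epsilon>/4"
    by (meson eventually_happens trivial_limit_sequentially)
  have Bn: "B n \<in> \<A>" using B(1) by blast
  have "\<Psi> (T - B n) = \<Psi> T - \<Psi> (B n)"
    using integral_function_Diff[OF Bn top sets_into_space[OF Bn]] .
  also have "\<dots> < \<epsilon>"
    using n near[OF Bn] near[OF top] e unfolding dist_real_def by linarith
  finally show ?thesis by blast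
qed

lemma countable_partition_tail:
  assumes \<Gamma>: "countable_partition T \<A> \<Gamma>" and "0 < \<epsilon>"
  obtains G where "finite G" "G \<subseteq> \<Gamma>" "\<Psi> (T - \<Union>G) < \<epsilon>"
proof (cases "finite \<Gamma>")
  case True
  then show thesis
    using \<Gamma> \<open>0 < \<epsilon>\<close> by (intro that[of \<Gamma>]) (auto simp: countable_partition_def partition_on_def)
next
  case False
  then have \<Gamma>': "\<Gamma> \<subseteq> \<A>" "\<Union>\<Gamma> = T" "countable \<Gamma>" "\<Gamma> \<noteq> {}"
    using \<Gamma> by (auto simp: countable_partition_def partition_on_def)
  define B where "B n = \<Union>(from_nat_into \<Gamma> ` {..<n})" for n
  have "from_nat_into \<Gamma> i \<in> \<A>" for i
    using subsetD[OF \<Gamma>'(1) from_nat_into[OF \<Gamma>'(4)]] .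
  then have "B n \<in> \<A>" for n
    unfolding B_def by (intro finite_Union) auto
  then have 1: "range B \<subseteq> \<A>" by blast
  have 2: "incseq B"
    unfolding B_def by (intro monoI Union_mono image_mono) auto
  have "(\<Union>n. B n) = \<Union>(range (from_nat_into \<Gamma>))"
    unfolding B_def by (auto intro: exI[of _ "Suc _"])
  then have 3: "(\<Union>n. B n) = T"
    using \<Gamma>' by (simp add: range_from_nat_into)
  obtain n where "\<Psi> (T - B n) < \<epsilon>"
    using integral_function_exhaustion[OF 1 2 3 \<open>0 < \<epsilon>\<close>] by blast
  then show thesis
    using \<Gamma>' from_nat_into[of \<Gamma>] by (intro that[of "from_nat_into \<Gamma> ` {..<n}"]) (auto simp: B_def)
qed

end

section \<open>Riemann sums of multifunctions\<close>

text \<open>The weight \<open>w\<close> and the family \<open>Q\<close> are free, so that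
  \<open>\<mu>\<close> can be exchanged for \<open>\<Psi>\<close> and partitions for parts of them.
  No closure is taken, as the Hausdorff distance does not see it.\<close>

definition riemann_sum ::
    "('a set \<Rightarrow> real) \<Rightarrow> ('a \<Rightarrow> 'x::real_vector set) \<Rightarrow> ('a set \<Rightarrow> 'a) \<Rightarrow> 'a set set \<Rightarrow> 'x set" where
  "riemann_sum w F t Q = (\<Sum>A\<in>Q. (\<lambda>x. w A *\<^sub>R x) ` F (t A))"

lemma riemann_sum_cong: "(\<And>A. A \<in> Q \<Longrightarrow> t A = s A) \<Longrightarrow> riemann_sum w F t Q = riemann_sum w F s Q"
  by (simp add: riemann_sum_def)

lemma riemann_sum_enumeration:
  assumes "inj_on a J"
  shows "(\<Sum>i\<in>{..<n} \<inter> J. (\<lambda>x. w (a i) *\<^sub>R x) ` F (t (a i))) = riemann_sum w F t (a ` ({..<n} \<inter> J))"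
  using inj_on_subset[OF assms, of "{..<n} \<inter> J"]
  by (simp add: riemann_sum_def sum.reindex comp_def)

lemma exists_enumeration:
  assumes "countable P"
  obtains a J where "enumeration a J P"
proof (cases "finite P")
  case True
  then show thesis
    using bij_betw_from_nat_into_finite[of P] that[of _ "{..<card P}"]
    by (auto simp: enumeration_def)
next
  case False
  then show thesis
    using bij_betw_from_nat_into[OF assms] that[of _ UNIV] by (auto simp: enumeration_def)
qed

lemma exists_tags:
  assumes "{} \<notin> P"
  obtains t where "\<And>A. A \<in> P \<Longrightarrow> t A \<in> A"
proof (rule that)
  fix A assume "A \<in> P"
  with assms have "A \<noteq> {}" by blast
  then show "(SOME x. x \<in> A) \<in> A" by (rule some_in_eq[THEN iffD2])
qed

lemma enumeration_covers_finite:
  assumes a: "enumeration a J P" and "finite G" "G \<subseteq> P"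
  shows "\<forall>\<^sub>F n in sequentially. G \<subseteq> a ` ({..<n} \<inter> J)"
proof -
  have "\<forall>\<^sub>F n in sequentially. E \<in> a ` ({..<n} \<inter> J)" if E: "E \<in> G" for E
  proof -
    obtain i where "i \<in> J" "a i = E"
      using a assms(3) E unfolding enumeration_def bij_betw_def by blast
    then show ?thesis
      by (intro eventually_mono[OF eventually_gt_at_top[of i]]) auto
  qed
  with \<open>finite G\<close> have "\<forall>\<^sub>F n in sequentially. \<forall>E\<in>G. E \<in> a ` ({..<n} \<inter> J)"
    by (simp add: eventually_ball_finite)
  then show ?thesis
    by eventually_elim auto
qed

section \<open>Riemann sums of a bounded multifunction; Gould and simple Birkhoff integrals\<close>

locale bounded_integrand = continuous_integrable_set_fun +
  fixes F :: "'a \<Rightarrow> 'x::banach set" and M :: real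
  assumes cwk_values: "x \<in> T \<Longrightarrow> F x \<in> cwk" and bound: "x \<in> T \<Longrightarrow> y \<in> F x \<Longrightarrow> norm y \<le> M"
    and M_nonneg: "0 \<le> M"
begin

lemma riemann_sum_cwk:
  assumes "\<And>A. A \<in> Q \<Longrightarrow> t A \<in> T"
  shows "riemann_sum w F t Q \<in> cwk"
  unfolding riemann_sum_def using assms by (intro cwk_sum cwk_scaleR cwk_values)

lemma riemann_sum_weights:
  assumes "\<And>A. A \<in> Q \<Longrightarrow> t A \<in> T"
  shows "hausdorff_distance (riemann_sum u F t Q) (riemann_sum v F t Q)
    \<le> ereal (M * (\<Sum>A\<in>Q. \<bar>u A - v A\<bar>))"
  unfolding riemann_sum_def sum_distrib_left
  using assms bound by (intro hausdorff_distance_sum hausdorff_distance_scaleR) auto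

text \<open>Omitting members amounts to giving them weight 0: a nonempty set scaled by 0 is
  \<open>{0}\<close>, the neutral element of Minkowski addition. This reduces the claim to a change
  of weights.\<close>

lemma riemann_sum_subset:
  assumes "finite Q'" "Q \<subseteq> Q'" and tags: "\<And>A. A \<in> Q' \<Longrightarrow> t A \<in> T"
  shows "hausdorff_distance (riemann_sum w F t Q') (riemann_sum w F t Q)
    \<le> ereal (M * (\<Sum>A\<in>Q' - Q. \<bar>w A\<bar>))"
proof -
  define v where "v A = (if A \<in> Q then w A else 0)" for A
  have "(\<lambda>x. v A *\<^sub>R x) ` F (t A) = 0" if "A \<in> Q' - Q" for A
  proof -
    have "F (t A) \<noteq> {}" using cwk_values[OF tags, of A] that by (auto simp: cwk_def)
    with that show ?thesis by (auto simp: v_def set_zero)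
  qed
  then have "riemann_sum v F t Q' = riemann_sum w F t Q"
    unfolding riemann_sum_def
    by (intro sum.mono_neutral_cong_right assms ballI) (auto simp: v_def)
  moreover have "(\<Sum>A\<in>Q'. \<bar>w A - v A\<bar>) = (\<Sum>A\<in>Q' - Q. \<bar>w A\<bar>)"
    by (intro sum.mono_neutral_cong_right assms) (auto simp: v_def)
  ultimately show ?thesis
    using riemann_sum_weights[of Q' t w v] tags by simp
qed

lemma bounded_riemann_sum:
  assumes "finite Q" "\<And>A. A \<in> Q \<Longrightarrow> t A \<in> T"
  shows "bounded (riemann_sum w F t Q)"
proof -
  have "bounded (riemann_sum w F t {})"
    by (simp add: riemann_sum_def set_zero)
  moreover have "hausdorff_distance (riemann_sum w F t {}) (riemann_sum w F t Q)
      \<le> ereal (M * (\<Sum>A\<in>Q - {}. \<bar>w A\<bar>))"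
    unfolding hausdorff_distance_commute[of "riemann_sum w F t {}"]
    using assms by (intro riemann_sum_subset) auto
  ultimately show ?thesis by (rule bounded_hausdorff_distance)
qed

lemma subordinate_family_subset:
  assumes "countable_partition T \<A> P'" "refines T P' P" "finite Q" "Q \<subseteq> P'"
  shows "subordinate_family \<A> P Q"
proof -
  have "disjoint Q"
    using assms(1,4) by (auto simp: countable_partition_def partition_on_def intro: pairwise_subset)
  with assms show ?thesis
    by (auto simp: subordinate_family_def countable_partition_def partition_on_def refines_def)
qed

lemma henstock_fine_sum_error:
  assumes "henstock_fine \<delta> P" "finite_partition T \<A> P'" "refines T P' P"
  shows "(\<Sum>A\<in>P'. \<bar>\<mu> A - \<Psi> A\<bar>) \<le> \<delta>"
proof -
  have "subordinate_family \<A> P P'"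
    using assms by (intro subordinate_family_subset[of P']) (auto simp: finite_imp_countable_partition finite_partition_def)
  with assms(1) show ?thesis by (simp add: henstock_fine_def)
qed

text \<open>The second bound controls \<open>\<mu>\<close> on many small sets at once:
  \<open>\<bar>\<mu> A\<bar>\<close> is at most
  \<open>\<bar>\<mu> A - \<Psi> A\<bar> + \<Psi> A\<close>, where the first terms obey the
  Saks-Henstock bound and the second ones add up.\<close>

lemma subordinate_sum_le:
  assumes R: "subordinate_family \<A> P R" and "\<Union>R \<subseteq> D" "D \<in> \<A>"
  shows "(\<Sum>A\<in>R. \<Psi> A) \<le> \<Psi> D" and "henstock_fine \<delta> P \<Longrightarrow> (\<Sum>A\<in>R. \<bar>\<mu> A\<bar>) \<le> \<delta> + \<Psi> D"
proof -
  have R': "finite R" "disjoint R" "R \<subseteq> \<A>"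
    using R by (auto simp: subordinate_family_def)
  then have "\<Union>R \<in> \<A>" by (auto intro: finite_Union)
  then show le: "(\<Sum>A\<in>R. \<Psi> A) \<le> \<Psi> D"
    using integral_function_Union[OF R'] integral_function_mono[OF _ assms(3,2)] by simp
  assume "henstock_fine \<delta> P"
  with R have "(\<Sum>A\<in>R. \<bar>\<mu> A - \<Psi> A\<bar>) \<le> \<delta>"
    by (simp add: henstock_fine_def)
  moreover have "(\<Sum>A\<in>R. \<bar>\<mu> A\<bar>) \<le> (\<Sum>A\<in>R. \<bar>\<mu> A - \<Psi> A\<bar> + \<Psi> A)"
    using R' integral_function_nonneg by (intro sum_mono) force
  ultimately show "(\<Sum>A\<in>R. \<bar>\<mu> A\<bar>) \<le> \<delta> + \<Psi> D"
    using le by (simp add: sum.distrib)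
qed

lemma tags_in_space:
  assumes "countable_partition T \<A> P" "\<And>A. A \<in> P \<Longrightarrow> t A \<in> A" "A \<in> P"
  shows "t A \<in> T"
  using assms by (auto simp: countable_partition_def partition_on_def)

text \<open>A partial sum runs over a finite piece \<open>Q\<close> of the countable partition.
  Completing \<open>Q\<close> to a finite partition makes the Gould condition applicable, and the
  added members carry little weight once \<open>Q\<close> contains the finite part
  \<open>G\<close>.\<close>

lemma gould_imp_birkhoff_simple:
  assumes "gould_integrable T \<A> \<mu> F"
  shows "birkhoff_simple_integrable T \<A> \<mu> F"
proof -
  obtain I where I: "I \<in> bf"
    and gould: "\<And>\<epsilon>. 0 < \<epsilon> \<Longrightarrow> \<exists>P0. finite_partition T \<A> P0 \<and>
      (\<forall>P t. finite_partition T \<A> P \<and> refines T P P0 \<and> (\<forall>A\<in>P. t A \<in> A) \<longrightarrow>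
        hausdorff_distance (riemann_sum \<mu> F t P) I < ereal \<epsilon>)"
    using assms unfolding gould_integrable_def riemann_sum_def by auto
  have "I \<in> cwk"
  proof (rule cwk_limit)
    show "closed I" "I \<noteq> {}" using I by (auto simp: bf_def)
  next
    fix e :: real assume "0 < e"
    with gould obtain P where P: "finite_partition T \<A> P"
      "\<And>t. (\<forall>A\<in>P. t A \<in> A) \<Longrightarrow> hausdorff_distance (riemann_sum \<mu> F t P) I < ereal e"
      by (metis refines_refl finite_partition_def)
    obtain t where t: "\<And>A. A \<in> P \<Longrightarrow> t A \<in> A"
      using exists_tags[of P] P(1) by (auto simp: finite_partition_def partition_on_def)
    have "riemann_sum \<mu> F t P \<in> cwk"
      using tags_in_space[OF finite_imp_countable_partition[OF P(1)] t] by (rule riemann_sum_cwk)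
    with P(2) t show "\<exists>S\<in>cwk. hausdorff_distance S I \<le> ereal e"
      by (meson less_imp_le)
  qed
  moreover have "\<exists>P0. countable_partition T \<A> P0 \<and>
      (\<forall>P a J t. countable_partition T \<A> P \<and> refines T P P0 \<and> enumeration a J P \<and> (\<forall>A\<in>P. t A \<in> A) \<longrightarrow>
        limsup (\<lambda>n. hausdorff_distance
          (closure (\<Sum>i\<in>{..<n} \<inter> J. (\<lambda>x. \<mu> (a i) *\<^sub>R x) ` F (t (a i)))) I) \<le> ereal \<epsilon>)"
    if "0 < \<epsilon>" for \<epsilon> :: real
  proof -
    \<comment> \<open>One \<open>\<delta>\<close> for the Gould condition; the added members cost
      \<open>M\<close> times \<open>2 * \<delta>\<close>, half from the Saks-Henstock bound and half
      from \<open>\<Psi> (T - \<Union>Q)\<close>.\<close>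
    define \<delta> where "\<delta> = \<epsilon> / (1 + 2 * M)"
    have "(1 + 2 * M) * \<delta> = \<epsilon>" "0 < \<delta>"
      using \<open>0 < \<epsilon>\<close> M_nonneg by (auto simp: \<delta>_def)
    then have \<delta>: "0 < \<delta>" "M * (2 * \<delta>) + \<delta> = \<epsilon>"
      by (auto simp: algebra_simps)
    obtain PG where PG: "finite_partition T \<A> PG"
      "\<And>P t. finite_partition T \<A> P \<Longrightarrow> refines T P PG \<Longrightarrow> (\<And>A. A \<in> P \<Longrightarrow> t A \<in> A) \<Longrightarrow>
        hausdorff_distance (riemann_sum \<mu> F t P) I < ereal \<delta>"
      using gould[OF \<delta>(1)] by blast
    obtain PH where PH: "henstock_fine \<delta> PH"
      using henstock[OF \<delta>(1)] .
    define P0 where "P0 = partition_meet PG PH"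
    have P0: "finite_partition T \<A> P0" "refines T P0 PG" "refines T P0 PH"
      using finite_partition_meet refines_meet PG(1) henstock_fine_partition[OF PH]
      by (auto simp: P0_def finite_partition_def)
    have "limsup (\<lambda>n. hausdorff_distance
          (closure (\<Sum>i\<in>{..<n} \<inter> J. (\<lambda>x. \<mu> (a i) *\<^sub>R x) ` F (t (a i)))) I) \<le> ereal \<epsilon>"
      if P: "countable_partition T \<A> P" "refines T P P0" and a: "enumeration a J P"
        and t: "\<And>A. A \<in> P \<Longrightarrow> t A \<in> A" for P a J t
    proof -
      obtain G where G: "finite G" "G \<subseteq> P" "\<Psi> (T - \<Union>G) < \<delta>"
        using countable_partition_tail[OF P(1) \<delta>(1)] .
      have "\<forall>\<^sub>F n in sequentially. hausdorff_distance (riemann_sum \<mu> F t (a ` ({..<n} \<inter> J))) I \<le> ereal \<epsilon>"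
        using enumeration_covers_finite[OF a G(1,2)]
      proof eventually_elim
        case (elim n)
        define Q where "Q = a ` ({..<n} \<inter> J)"
        have Q: "finite Q" "Q \<subseteq> P" "G \<subseteq> Q"
          using elim a by (auto simp: Q_def enumeration_def bij_betw_def)
        then have sub: "subordinate_family \<A> P0 Q"
          using subordinate_family_subset[OF P(1,2)] by blast
        have QA: "\<Union>Q \<in> \<A>" "\<Union>G \<in> \<A>"
          using Q G(1) P(1) by (auto simp: countable_partition_def intro!: finite_Union)
        have small: "\<Psi> (T - \<Union>Q) \<le> \<delta>"
          using integral_function_mono[of "T - \<Union>Q" "T - \<Union>G"] QA Q(3) G(3) by force
        define P' where "P' = partition_completion Q P0"
        have P0_refl: "refines T P0 P0"
          using P0(1) by (auto simp: finite_partition_def intro: refines_refl)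
        have P': "finite_partition T \<A> P'" "refines T P' P0"
          using partition_completion(1,2)[OF sub P0(1) P0_refl] by (auto simp: P'_def)
        obtain s where s: "\<And>A. A \<in> P' \<Longrightarrow> s A \<in> A"
          using exists_tags[of P'] P'(1) by (auto simp: finite_partition_def partition_on_def)
        define t' where "t' A = (if A \<in> Q then t A else s A)" for A
        have t': "\<And>A. A \<in> P' \<Longrightarrow> t' A \<in> A"
          using s t Q by (auto simp: t'_def)
        have "hausdorff_distance (riemann_sum \<mu> F t' P') I \<le> ereal \<delta>"
          using PG(2)[OF P'(1) refines_trans[OF P'(2) P0(2)] t'] by (rule less_imp_le)
        moreover have "hausdorff_distance (riemann_sum \<mu> F t' Q) (riemann_sum \<mu> F t' P')
            \<le> ereal (M * (\<Sum>A\<in>P' - Q. \<bar>\<mu> A\<bar>))"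
          unfolding hausdorff_distance_commute[of "riemann_sum \<mu> F t' Q"]
          using P'(1) tags_in_space[OF finite_imp_countable_partition[OF P'(1)] t']
          by (intro riemann_sum_subset) (auto simp: finite_partition_def P'_def partition_completion_def)
        ultimately have "hausdorff_distance (riemann_sum \<mu> F t' Q) I
            \<le> ereal (M * (\<Sum>A\<in>P' - Q. \<bar>\<mu> A\<bar>) + \<delta>)"
          by (rule hausdorff_distance_triangle[rotated])
        also have "(\<Sum>A\<in>P' - Q. \<bar>\<mu> A\<bar>) \<le> 2 * \<delta>"
        proof -
          have "subordinate_family \<A> PH (P' - Q)"
            using P' by (intro subordinate_family_subset[OF finite_imp_countable_partition[OF P'(1)]
                  refines_trans[OF P'(2) P0(3)]]) (auto simp: finite_partition_def)
          moreover have "\<Union>(P' - Q) \<subseteq> T - \<Union>Q"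
            using P0(1) by (auto simp: P'_def partition_completion_def finite_partition_def partition_on_def)
          ultimately have "(\<Sum>A\<in>P' - Q. \<bar>\<mu> A\<bar>) \<le> \<delta> + \<Psi> (T - \<Union>Q)"
            using PH QA(1) by (intro subordinate_sum_le) auto
          with small show ?thesis by simp
        qed
        then have "ereal (M * (\<Sum>A\<in>P' - Q. \<bar>\<mu> A\<bar>) + \<delta>) \<le> ereal (M * (2 * \<delta>) + \<delta>)"
          using M_nonneg by (simp add: mult_left_mono)
        finally have "hausdorff_distance (riemann_sum \<mu> F t' Q) I \<le> ereal \<epsilon>"
          by (simp add: \<delta>(2))
        moreover have "riemann_sum \<mu> F t' Q = riemann_sum \<mu> F t Q"
          by (rule riemann_sum_cong) (simp add: t'_def)
        ultimately show ?case by (simp add: Q_def)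
      qed
      moreover have "inj_on a J"
        using a by (simp add: enumeration_def bij_betw_def)
      ultimately show ?thesis
        by (intro Limsup_bounded) (simp add: riemann_sum_enumeration)
    qed
    with finite_imp_countable_partition[OF P0(1)] show ?thesis
      by (intro exI[of _ P0] conjI allI impI) auto
  qed
  ultimately show ?thesis
    unfolding birkhoff_simple_integrable_def by (intro bexI[of _ I] allI impI)
qed

lemma henstock_fine_refines:
  assumes P: "henstock_fine \<delta> P" and P': "finite_partition T \<A> P'" "refines T P' P"
  shows "henstock_fine \<delta> P'"
proof -
  have "subordinate_family \<A> P Q" if Q: "subordinate_family \<A> P' Q" for Q
  proof -
    have "\<exists>B\<in>P. A \<subseteq> B" if "A \<in> Q" for A
    proof -
      obtain B C where "A \<subseteq> B" "B \<subseteq> C" "C \<in> P"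
        using Q P'(2) \<open>A \<in> Q\<close> unfolding subordinate_family_def refines_def by meson
      then show ?thesis by blast
    qed
    with Q show ?thesis by (simp add: subordinate_family_def)
  qed
  with P P'(1) show ?thesis by (simp add: henstock_fine_def)
qed

text \<open>A finite substitute for \<open>\<Gamma>\<close>: all but finitely many members are
  lumped into the single set \<open>T - \<Union>G\<close>, obtained by completing \<open>G\<close>
  inside the trivial partition.\<close>

lemma truncated_partition:
  assumes \<Gamma>: "countable_partition T \<A> \<Gamma>" and "0 < \<delta>"
  obtains G P0 where "finite G" "G \<subseteq> \<Gamma>" "\<Psi> (T - \<Union>G) < \<delta>" "henstock_fine \<delta> P0"
    and "\<forall>P. refines T P P0 \<longrightarrow> (\<forall>A\<in>P. (\<exists>E\<in>G. A \<subseteq> E) \<or> A \<subseteq> T - \<Union>G)"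
proof -
  obtain G where G: "finite G" "G \<subseteq> \<Gamma>" "\<Psi> (T - \<Union>G) < \<delta>"
    using countable_partition_tail[OF assms] .
  obtain PH where PH: "henstock_fine \<delta> PH"
    using henstock[OF \<open>0 < \<delta>\<close>] .
  define PT where "PT = {T} - {{}}"
  have PT: "finite_partition T \<A> PT" "refines T PT PT"
    using finite_partition_space by (auto simp: PT_def finite_partition_def intro: refines_refl)
  have \<Gamma>': "partition_on T \<Gamma>" using \<Gamma> by (simp add: countable_partition_def)
  have "refines T \<Gamma> PT"
    using \<Gamma>' PT(1) unfolding refines_def PT_def finite_partition_def partition_on_def by auto
  then have sub: "subordinate_family \<A> PT G"
    using G(1,2) by (rule subordinate_family_subset[OF \<Gamma>])
  define PG where "PG = partition_completion G PT"
  have PG: "finite_partition T \<A> PG"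
    using partition_completion(1)[OF sub PT] by (simp add: PG_def)
  have meet: "refines T (partition_meet PG PH) PG" "refines T (partition_meet PG PH) PH"
    using refines_meet PG henstock_fine_partition[OF PH] by (auto simp: finite_partition_def)
  show thesis
  proof (rule that[OF G])
    show "henstock_fine \<delta> (partition_meet PG PH)"
      using PH finite_partition_meet[OF PG henstock_fine_partition[OF PH]] meet(2)
      by (rule henstock_fine_refines)
  next
    show "\<forall>P. refines T P (partition_meet PG PH) \<longrightarrow> (\<forall>A\<in>P. (\<exists>E\<in>G. A \<subseteq> E) \<or> A \<subseteq> T - \<Union>G)"
    proof (intro allI impI ballI)
      fix P A assume P: "refines T P (partition_meet PG PH)" "A \<in> P"
      from refines_trans[OF P(1) meet(1)] P(2) obtain B where "B \<in> PG" "A \<subseteq> B"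
        unfolding refines_def by blast
      then show "(\<exists>E\<in>G. A \<subseteq> E) \<or> A \<subseteq> T - \<Union>G"
        by (auto simp: PG_def partition_completion_def PT_def)
    qed
  qed
qed

text \<open>Members of \<open>P\<close> inside a member of \<open>G\<close> keep their tags, while
  the others are cut by \<open>\<Gamma>\<close>. The countable partition so obtained is covered by
  the hypothesis, and the two sums differ only on families inside
  \<open>T - \<Union>G\<close>.\<close>

lemma birkhoff_simple_imp_gould:
  assumes "birkhoff_simple_integrable T \<A> \<mu> F"
  shows "gould_integrable T \<A> \<mu> F"
proof -
  obtain I where I: "I \<in> cwk"
    and bsi: "\<And>\<epsilon>. 0 < \<epsilon> \<Longrightarrow> \<exists>P0. countable_partition T \<A> P0 \<and>
      (\<forall>P a J t. countable_partition T \<A> P \<and> refines T P P0 \<and> enumeration a J P \<and> (\<forall>A\<in>P. t A \<in> A) \<longrightarrow>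
        limsup (\<lambda>n. hausdorff_distance
          (closure (\<Sum>i\<in>{..<n} \<inter> J. (\<lambda>x. \<mu> (a i) *\<^sub>R x) ` F (t (a i)))) I) \<le> ereal \<epsilon>)"
    using assms unfolding birkhoff_simple_integrable_def by auto
  have main: "\<exists>P0. finite_partition T \<A> P0 \<and>
      (\<forall>P t. finite_partition T \<A> P \<and> refines T P P0 \<and> (\<forall>A\<in>P. t A \<in> A) \<longrightarrow>
        hausdorff_distance (riemann_sum \<mu> F t P) I < ereal \<epsilon>)"
    if "0 < \<epsilon>" for \<epsilon> :: real
  proof -
    \<comment> \<open>Either tail costs \<open>M * (2 * \<delta>)\<close>; the hypothesis costs
      \<open>2 * \<delta>\<close>, as a limsup of at most \<open>\<delta>\<close> bounds the terms
      only by larger numbers. The third \<open>\<delta>\<close> makes the result strict.\<close>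
    define \<delta> where "\<delta> = \<epsilon> / (3 + 4 * M)"
    have "(3 + 4 * M) * \<delta> = \<epsilon>" and \<delta>: "0 < \<delta>"
      using \<open>0 < \<epsilon>\<close> M_nonneg by (auto simp: \<delta>_def)
    then have \<delta>_less: "M * (2 * \<delta>) + (M * (2 * \<delta>) + 2 * \<delta>) < \<epsilon>"
      by (auto simp: algebra_simps)
    obtain \<Gamma> where \<Gamma>: "countable_partition T \<A> \<Gamma>"
      "\<And>P a J t. countable_partition T \<A> P \<Longrightarrow> refines T P \<Gamma> \<Longrightarrow> enumeration a J P \<Longrightarrow>
        (\<And>A. A \<in> P \<Longrightarrow> t A \<in> A) \<Longrightarrow>
        limsup (\<lambda>n. hausdorff_distance
          (closure (\<Sum>i\<in>{..<n} \<inter> J. (\<lambda>x. \<mu> (a i) *\<^sub>R x) ` F (t (a i)))) I) \<le> ereal \<delta>"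
      using bsi[OF \<delta>] by blast
    obtain G P0 where G: "finite G" "G \<subseteq> \<Gamma>" "\<Psi> (T - \<Union>G) < \<delta>" and P0: "henstock_fine \<delta> P0"
      and "\<forall>P. refines T P P0 \<longrightarrow> (\<forall>A\<in>P. (\<exists>E\<in>G. A \<subseteq> E) \<or> A \<subseteq> T - \<Union>G)"
      using truncated_partition[OF \<Gamma>(1) \<delta>] .
    then have split: "(\<exists>E\<in>G. A \<subseteq> E) \<or> A \<subseteq> T - \<Union>G" if "refines T P P0" "A \<in> P" for P A
      using that by blast
    have tail: "T - \<Union>G \<in> \<A>"
      using G(1,2) \<Gamma>(1) by (auto simp: countable_partition_def intro!: finite_Union)
    have "hausdorff_distance (riemann_sum \<mu> F t P) I < ereal \<epsilon>"
      if P: "finite_partition T \<A> P" "refines T P P0" and t: "\<And>A. A \<in> P \<Longrightarrow> t A \<in> A" for P t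
    proof -
      define Q where "Q = {A \<in> P. \<exists>E\<in>G. A \<subseteq> E}"
      define P' where "P' = partition_meet P \<Gamma>"
      have PC: "countable_partition T \<A> P"
        using P(1) by (rule finite_imp_countable_partition)
      have P': "countable_partition T \<A> P'"
        unfolding P'_def using PC \<Gamma>(1) by (rule countable_partition_meet)
      have ref: "refines T P' P" "refines T P' \<Gamma>"
        unfolding P'_def using PC \<Gamma>(1) by (auto simp: countable_partition_def intro: refines_meet)
      have QP': "Q \<subseteq> P'"
        using G(2) unfolding Q_def P'_def by (auto intro: refines_meet_mono[OF P(2)])
      have "finite Q" using P(1) by (auto simp: Q_def finite_partition_def)
      obtain s where s: "\<And>A. A \<in> P' \<Longrightarrow> s A \<in> A"
        using exists_tags[of P'] P' by (auto simp: countable_partition_def partition_on_def)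
      define t' where "t' A = (if A \<in> Q then t A else s A)" for A
      have t': "\<And>A. A \<in> P' \<Longrightarrow> t' A \<in> A"
        using s t by (auto simp: t'_def Q_def)
      obtain a J where a: "enumeration a J P'"
        using exists_enumeration P' by (auto simp: countable_partition_def)
      let ?h = "\<lambda>n. hausdorff_distance (riemann_sum \<mu> F t' (a ` ({..<n} \<inter> J))) I"
      have "inj_on a J"
        using a by (simp add: enumeration_def bij_betw_def)
      then have "limsup ?h \<le> ereal \<delta>"
        using \<Gamma>(2)[OF P' ref(2) a t'] by (simp add: riemann_sum_enumeration)
      also have "\<dots> < ereal (2 * \<delta>)"
        using \<delta> by simp
      finally have "\<forall>\<^sub>F n in sequentially. ?h n < ereal (2 * \<delta>)"
        by (rule Limsup_lessD)
      then have "\<forall>\<^sub>F n in sequentially. ?h n < ereal (2 * \<delta>) \<and> Q \<subseteq> a ` ({..<n} \<inter> J)"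
        using enumeration_covers_finite[OF a \<open>finite Q\<close> QP'] by (rule eventually_conj)
      then obtain n where n: "?h n < ereal (2 * \<delta>)" "Q \<subseteq> a ` ({..<n} \<inter> J)"
        by (auto simp: eventually_sequentially)
      define Q' where "Q' = a ` ({..<n} \<inter> J)"
      have Q': "finite Q'" "Q' \<subseteq> P'" "Q \<subseteq> Q'"
        using n(2) a by (auto simp: Q'_def enumeration_def bij_betw_def)
      \<comment> \<open>Otherwise \<open>A = B \<inter> E\<close> with \<open>B\<close> inside some
        member \<open>E'\<close> of \<open>G\<close>; by disjointness \<open>E = E'\<close>, so the
        meet left \<open>B\<close> uncut and \<open>A\<close> is in \<open>Q\<close>.\<close>
      have "A \<subseteq> T - \<Union>G" if A: "A \<in> P' - Q" for A
      proof (rule ccontr)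
        assume nsub: "\<not> A \<subseteq> T - \<Union>G"
        obtain B E where BE: "A = B \<inter> E" "B \<in> P" "E \<in> \<Gamma>" "A \<noteq> {}"
          using A by (auto simp: P'_def partition_meet_def)
        then obtain E' where E': "E' \<in> G" "B \<subseteq> E'"
          using split[OF P(2) BE(2)] nsub by blast
        have "E = E'"
        proof (rule ccontr)
          assume "E \<noteq> E'"
          then have "E \<inter> E' = {}"
            using \<Gamma>(1) G(2) E'(1) BE(3)
            by (auto simp: countable_partition_def partition_on_def dest: disjointD)
          with E'(2) BE show False by blast
        qed
        with E' BE have "A = B" by blast
        with A BE E' show False by (auto simp: Q_def)
      qed
      then have "\<Union>(Q' - Q) \<subseteq> T - \<Union>G"
        using Q'(2) by blast
      moreover have "subordinate_family \<A> P0 (Q' - Q)"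
        using Q' by (intro subordinate_family_subset[OF P' refines_trans[OF ref(1) P(2)]]) auto
      ultimately have sum1: "(\<Sum>A\<in>Q' - Q. \<bar>\<mu> A\<bar>) \<le> 2 * \<delta>"
        using subordinate_sum_le(2)[OF _ _ tail P0] G(3) by fastforce
      have "\<Union>(P - Q) \<subseteq> T - \<Union>G"
        using split[OF P(2)] unfolding Q_def by blast
      moreover have "subordinate_family \<A> P0 (P - Q)"
        using P(1) by (intro subordinate_family_subset[OF PC P(2)]) (auto simp: finite_partition_def)
      ultimately have sum2: "(\<Sum>A\<in>P - Q. \<bar>\<mu> A\<bar>) \<le> 2 * \<delta>"
        using subordinate_sum_le(2)[OF _ _ tail P0] G(3) by fastforce
      have "hausdorff_distance (riemann_sum \<mu> F t P) (riemann_sum \<mu> F t Q)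
          \<le> ereal (M * (\<Sum>A\<in>P - Q. \<bar>\<mu> A\<bar>))"
        using P(1) tags_in_space[OF PC t]
        by (intro riemann_sum_subset) (auto simp: Q_def finite_partition_def)
      also have "\<dots> \<le> ereal (M * (2 * \<delta>))"
        using sum2 M_nonneg by (simp add: mult_left_mono)
      finally have h1: "hausdorff_distance (riemann_sum \<mu> F t P) (riemann_sum \<mu> F t Q)
          \<le> ereal (M * (2 * \<delta>))" .
      have "hausdorff_distance (riemann_sum \<mu> F t' Q') (riemann_sum \<mu> F t' Q)
          \<le> ereal (M * (\<Sum>A\<in>Q' - Q. \<bar>\<mu> A\<bar>))"
        using Q' tags_in_space[OF P' t']
        by (intro riemann_sum_subset) auto
      also have "\<dots> \<le> ereal (M * (2 * \<delta>))"
        using sum1 M_nonneg by (simp add: mult_left_mono)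
      finally have h2: "hausdorff_distance (riemann_sum \<mu> F t' Q) (riemann_sum \<mu> F t' Q')
          \<le> ereal (M * (2 * \<delta>))"
        by (simp add: hausdorff_distance_commute)
      have h3: "hausdorff_distance (riemann_sum \<mu> F t' Q') I \<le> ereal (2 * \<delta>)"
        using n(1) by (simp add: Q'_def)
      have "riemann_sum \<mu> F t' Q = riemann_sum \<mu> F t Q"
        by (rule riemann_sum_cong) (simp add: t'_def)
      with h1 have "hausdorff_distance (riemann_sum \<mu> F t P) (riemann_sum \<mu> F t' Q)
          \<le> ereal (M * (2 * \<delta>))" by simp
      from this hausdorff_distance_triangle[OF h2 h3]
      have "hausdorff_distance (riemann_sum \<mu> F t P) I
          \<le> ereal (M * (2 * \<delta>) + (M * (2 * \<delta>) + 2 * \<delta>))"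
        by (rule hausdorff_distance_triangle)
      also have "\<dots> < ereal \<epsilon>" using \<delta>_less by simp
      finally show ?thesis .
    qed
    with henstock_fine_partition[OF P0] show ?thesis
      by (intro exI[of _ P0] conjI allI impI) auto
  qed
  \<comment> \<open>The closure has the same Hausdorff distances as \<open>I\<close>. Boundedness is
    inherited from a Riemann sum at distance at most 1.\<close>
  have "closure I \<in> bf"
  proof -
    obtain P where P: "finite_partition T \<A> P"
      "\<And>t. (\<forall>A\<in>P. t A \<in> A) \<Longrightarrow> hausdorff_distance (riemann_sum \<mu> F t P) I < ereal 1"
      using main[of 1] by (metis refines_refl finite_partition_def zero_less_one)
    obtain t where t: "\<And>A. A \<in> P \<Longrightarrow> t A \<in> A"
      using exists_tags[of P] P(1) by (auto simp: finite_partition_def partition_on_def)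
    have "bounded (riemann_sum \<mu> F t P)"
      using P(1) tags_in_space[OF finite_imp_countable_partition[OF P(1)] t]
      by (intro bounded_riemann_sum) (auto simp: finite_partition_def)
    moreover have "hausdorff_distance (riemann_sum \<mu> F t P) I \<le> ereal 1"
      using P(2) t by (auto intro: less_imp_le)
    ultimately have "bounded I"
      by (rule bounded_hausdorff_distance)
    then show ?thesis
      using I by (auto simp: bf_def cwk_def)
  qed
  with main show ?thesis
    unfolding gould_integrable_def riemann_sum_def[symmetric]
    by (intro bexI[of _ "closure I"]) simp_all
qed

end

section \<open>The Birkhoff integral\<close>

lemma singleton_zero_cwk: "{0} \<in> cwk"
  by (simp add: cwk_iff)

lemma radstroem_embedding_add:
  "radstroem_embedding j \<Longrightarrow> A \<in> cwk \<Longrightarrow> C \<in> cwk \<Longrightarrow> 0 \<le> \<alpha> \<Longrightarrow>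
    j (A + (\<lambda>x. \<alpha> *\<^sub>R x) ` C) = j A + \<alpha> *\<^sub>R j C"
  unfolding radstroem_embedding_def
  by (elim conjE) (drule bspec[of _ _ A], assumption, drule bspec[of _ _ C], assumption,
    drule spec[of _ 1], simp)

lemma radstroem_embedding_zero:
  assumes "radstroem_embedding j"
  shows "j {0} = 0"
  using radstroem_embedding_add[OF assms singleton_zero_cwk singleton_zero_cwk, of 1]
  by (simp add: set_plus_def)

lemma norm_radstroem_embedding_diff:
  "radstroem_embedding j \<Longrightarrow> A \<in> cwk \<Longrightarrow> C \<in> cwk \<Longrightarrow>
    hausdorff_distance A C \<le> ereal r \<longleftrightarrow> norm (j A - j C) \<le> r"
  by (simp add: radstroem_embedding_def)

text \<open>Dividing by the total weight \<open>W\<close> exhibits the sum as a convex combination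
  of the points \<open>W *\<^sub>R f (t A)\<close>. If \<open>W\<close> vanishes, so do all weights,
  and the hull is that of \<open>{0}\<close>.\<close>

lemma refined_sum_in_convex_hull:
  fixes f :: "'a \<Rightarrow> 'b::real_vector"
  assumes "finite R" and tags: "\<And>A. A \<in> R \<Longrightarrow> t A \<in> E" and nonneg: "\<And>A. A \<in> R \<Longrightarrow> 0 \<le> w A"
    and "E \<noteq> {}"
  shows "(\<Sum>A\<in>R. w A *\<^sub>R f (t A)) \<in> convex hull ((\<lambda>x. (\<Sum>A\<in>R. w A) *\<^sub>R f x) ` E)"
proof (cases "(\<Sum>A\<in>R. w A) = 0")
  case True
  then have "(\<Sum>A\<in>R. w A *\<^sub>R f (t A)) = 0"
    using sum_nonneg_eq_0_iff[OF \<open>finite R\<close> nonneg] by simp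
  with True \<open>E \<noteq> {}\<close> show ?thesis by (auto simp: hull_inc)
next
  case False
  define W where "W = (\<Sum>A\<in>R. w A)"
  have W: "0 < W"
    using False sum_nonneg[of R w] nonneg by (simp add: W_def less_le)
  have "(\<Sum>A\<in>R. (w A / W) *\<^sub>R (W *\<^sub>R f (t A))) \<in> convex hull ((\<lambda>x. W *\<^sub>R f x) ` E)"
  proof (rule convex_sum)
    show "(\<Sum>A\<in>R. w A / W) = 1"
      using W by (simp add: W_def flip: sum_divide_distrib)
  qed (use W nonneg tags \<open>finite R\<close> in \<open>auto intro: hull_inc\<close>)
  moreover have "(\<Sum>A\<in>R. (w A / W) *\<^sub>R (W *\<^sub>R f (t A))) = (\<Sum>A\<in>R. w A *\<^sub>R f (t A))"
    using W by simp
  ultimately show ?thesis by (simp add: W_def)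
qed

text \<open>Balls are convex, so a ball that contains \<open>D\<close> contains its hull. This is
  used twice: for centres in \<open>D\<close>, then for a centre in the hull.\<close>

lemma dist_convex_hull_le:
  fixes D :: "'b::real_normed_vector set"
  assumes D: "\<And>x y. x \<in> D \<Longrightarrow> y \<in> D \<Longrightarrow> norm (x - y) \<le> d"
    and xy: "x \<in> convex hull D" "y \<in> convex hull D"
  shows "norm (x - y) \<le> d"
proof -
  have 1: "convex hull D \<subseteq> cball z d" if "z \<in> D" for z
    using D[OF that] by (intro hull_minimal) (auto simp: dist_norm)
  have "convex hull D \<subseteq> cball x d"
    using subsetD[OF 1 xy(1)] by (intro hull_minimal) (auto simp: dist_commute)
  with xy(2) show ?thesis by (auto simp: dist_norm)
qed

section \<open>Gould and Birkhoff integrals\<close>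

context bounded_integrand
begin

text \<open>The weights are nonnegative because \<open>j\<close> respects only nonnegative
  multiples.\<close>

lemma radstroem_embedding_riemann_sum:
  assumes j: "radstroem_embedding j" and "finite Q" and "\<And>A. A \<in> Q \<Longrightarrow> t A \<in> T"
    and "\<And>A. A \<in> Q \<Longrightarrow> 0 \<le> w A"
  shows "j (riemann_sum w F t Q) = (\<Sum>A\<in>Q. w A *\<^sub>R j (F (t A)))"
  using assms(2-)
proof (induction Q rule: finite_induct)
  case empty
  then show ?case
    using radstroem_embedding_zero[OF j] by (simp add: riemann_sum_def set_zero)
next
  case (insert A Q)
  then have "j (riemann_sum w F t Q + (\<lambda>x. w A *\<^sub>R x) ` F (t A)) = j (riemann_sum w F t Q) + w A *\<^sub>R j (F (t A))"
    by (intro radstroem_embedding_add[OF j] riemann_sum_cwk cwk_values) auto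
  with insert show ?case
    by (simp add: riemann_sum_def add.commute)
qed

lemma norm_radstroem_embedding_le:
  assumes j: "radstroem_embedding j" and x: "x \<in> T"
  shows "norm (j (F x)) \<le> M"
proof -
  have "hausdorff_distance (F x) {0} \<le> ereal M"
    using bound[OF x] cwk_values[OF x] by (intro hausdorff_distance_leI) (auto simp: cwk_def)
  then show ?thesis
    using norm_radstroem_embedding_diff[OF j cwk_values[OF x] singleton_zero_cwk]
      radstroem_embedding_zero[OF j] by simp
qed

text \<open>A finite partition already serves as \<open>\<Gamma>\<close>, which makes every series a
  finite sum. The diameter is at most twice the bound on the distance to \<open>I\<close>, by the
  isometry of \<open>j\<close>.\<close>

lemma gould_imp_birkhoff:
  assumes gould: "gould_integrable T \<A> \<mu> F" and j: "radstroem_embedding j"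
  shows "birkhoff_integrable j T \<A> \<Psi> F"
  unfolding birkhoff_integrable_def birkhoff_integrable_fun_def
proof (intro allI impI)
  fix \<epsilon> :: real assume "0 < \<epsilon>"
  define \<delta> where "\<delta> = \<epsilon> / (3 + 2 * M)"
  have "(3 + 2 * M) * \<delta> = \<epsilon>" and \<delta>: "0 < \<delta>"
    using \<open>0 < \<epsilon>\<close> M_nonneg by (auto simp: \<delta>_def)
  then have \<delta>_less: "(M * \<delta> + \<delta>) + (M * \<delta> + \<delta>) < \<epsilon>"
    by (auto simp: algebra_simps)
  obtain I PG where PG: "finite_partition T \<A> PG"
    "\<And>P t. finite_partition T \<A> P \<Longrightarrow> refines T P PG \<Longrightarrow> (\<And>A. A \<in> P \<Longrightarrow> t A \<in> A) \<Longrightarrow>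
      hausdorff_distance (riemann_sum \<mu> F t P) I < ereal \<delta>"
    using gould \<delta> unfolding gould_integrable_def riemann_sum_def[symmetric] hausdorff_distance_closure_left
    by blast
  obtain PH where PH: "henstock_fine \<delta> PH"
    using henstock[OF \<delta>] .
  define \<Gamma> where "\<Gamma> = partition_meet PG PH"
  have \<Gamma>: "finite_partition T \<A> \<Gamma>" "refines T \<Gamma> PG" "refines T \<Gamma> PH"
    using finite_partition_meet refines_meet PG(1) henstock_fine_partition[OF PH]
    by (auto simp: \<Gamma>_def finite_partition_def)
  then have \<Gamma>': "finite \<Gamma>" "\<Gamma> \<subseteq> \<A>" "\<And>A. A \<in> \<Gamma> \<Longrightarrow> A \<subseteq> T" "countable_partition T \<A> \<Gamma>"
    using finite_imp_countable_partition by (auto simp: finite_partition_def partition_on_def)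
  let ?f = "j \<circ> F"
  let ?v = "\<lambda>t. \<Sum>A\<in>\<Gamma>. \<Psi> A *\<^sub>R ?f (t A)"
  have close: "norm (?v t - ?v s) \<le> (M * \<delta> + \<delta>) + (M * \<delta> + \<delta>)"
    if t: "\<And>A. A \<in> \<Gamma> \<Longrightarrow> t A \<in> A" and s: "\<And>A. A \<in> \<Gamma> \<Longrightarrow> s A \<in> A" for t s
  proof -
    have near: "hausdorff_distance (riemann_sum \<Psi> F u \<Gamma>) I \<le> ereal (M * \<delta> + \<delta>)"
      if u: "\<And>A. A \<in> \<Gamma> \<Longrightarrow> u A \<in> A" for u
    proof (rule hausdorff_distance_triangle)
      have "(\<Sum>A\<in>\<Gamma>. \<bar>\<Psi> A - \<mu> A\<bar>) \<le> \<delta>"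
        using henstock_fine_sum_error[OF PH \<Gamma>(1,3)] by (simp add: abs_minus_commute)
      then have "ereal (M * (\<Sum>A\<in>\<Gamma>. \<bar>\<Psi> A - \<mu> A\<bar>)) \<le> ereal (M * \<delta>)"
        using M_nonneg by (simp add: mult_left_mono)
      with riemann_sum_weights[of \<Gamma> u \<Psi> \<mu>] tags_in_space[OF \<Gamma>'(4) u]
      show "hausdorff_distance (riemann_sum \<Psi> F u \<Gamma>) (riemann_sum \<mu> F u \<Gamma>) \<le> ereal (M * \<delta>)"
        by (meson order_trans)
      show "hausdorff_distance (riemann_sum \<mu> F u \<Gamma>) I \<le> ereal \<delta>"
        using PG(2)[OF \<Gamma>(1,2) u] by (rule less_imp_le)
    qed
    have T: "\<And>A. A \<in> \<Gamma> \<Longrightarrow> t A \<in> T" "\<And>A. A \<in> \<Gamma> \<Longrightarrow> s A \<in> T"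
      using tags_in_space[OF \<Gamma>'(4)] t s by auto
    have \<Psi>: "\<And>A. A \<in> \<Gamma> \<Longrightarrow> 0 \<le> \<Psi> A"
      using \<Gamma>'(2) integral_function_nonneg by blast
    have "hausdorff_distance (riemann_sum \<Psi> F t \<Gamma>) (riemann_sum \<Psi> F s \<Gamma>)
        \<le> ereal ((M * \<delta> + \<delta>) + (M * \<delta> + \<delta>))"
      using near[OF t] near[OF s] unfolding hausdorff_distance_commute[of _ I]
      by (rule hausdorff_distance_triangle[OF _ , of _ I, unfolded hausdorff_distance_commute[of _ I]])
    then show ?thesis
      using norm_radstroem_embedding_diff[OF j riemann_sum_cwk riemann_sum_cwk, of \<Gamma> t \<Gamma> s \<Psi> \<Psi>] T
        radstroem_embedding_riemann_sum[OF j \<Gamma>'(1) T(1) \<Psi>] radstroem_embedding_riemann_sum[OF j \<Gamma>'(1) T(2) \<Psi>]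
      by simp
  qed
  define S where "S = {infsum (\<lambda>A. \<Psi> A *\<^sub>R ?f (t A)) \<Gamma> | t. \<forall>A\<in>\<Gamma>. t A \<in> A}"
  have S: "norm (x - y) \<le> (M * \<delta> + \<delta>) + (M * \<delta> + \<delta>)" if "x \<in> S" "y \<in> S" for x y
    using that close \<Gamma>'(1) by (auto simp: S_def)
  have "bounded S"
  proof (cases "S = {}")
    case False
    then obtain x where "x \<in> S" by blast
    then show ?thesis
      using S by (intro bounded_subset[OF bounded_cball[of x "(M * \<delta> + \<delta>) + (M * \<delta> + \<delta>)"]]) (auto simp: dist_norm)
  qed simp
  moreover have "diameter S \<le> (M * \<delta> + \<delta>) + (M * \<delta> + \<delta>)"
    using S M_nonneg \<delta> by (intro diameter_le) auto
  moreover have "bounded (?f ` A)" if "A \<in> \<Gamma>" for A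
    using norm_radstroem_embedding_le[OF j] \<Gamma>'(3)[OF that] by (auto simp: bounded_iff)
  ultimately show "\<exists>\<Gamma>. countable_partition T \<A> \<Gamma> \<and> (\<forall>A\<in>\<Gamma>. 0 < \<Psi> A \<longrightarrow> bounded (?f ` A)) \<and>
      (\<forall>t. (\<forall>A\<in>\<Gamma>. t A \<in> A) \<longrightarrow> (\<lambda>A. \<Psi> A *\<^sub>R ?f (t A)) summable_on \<Gamma>) \<and>
      (let S = {infsum (\<lambda>A. \<Psi> A *\<^sub>R ?f (t A)) \<Gamma> | t. \<forall>A\<in>\<Gamma>. t A \<in> A} in bounded S \<and> diameter S < \<epsilon>)"
    using \<Gamma>'(1,4) \<delta>_less unfolding S_def Let_def by (intro exI[of _ \<Gamma>]) auto
qed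

text \<open>Additivity of \<open>\<Psi>\<close> is decisive: the total weight of the pieces of
  \<open>E\<close> is \<open>\<Psi> E\<close>, so a refined sum over \<open>G\<close> is an average
  of sums with one tag per member and stays in the convex hull of \<open>D\<close>.\<close>

lemma birkhoff_imp_gould_Cauchy:
  assumes birkhoff: "birkhoff_integrable j T \<A> \<Psi> F" and j: "radstroem_embedding j" and "0 < \<epsilon>"
  shows "\<exists>P0. finite_partition T \<A> P0 \<and>
    (\<forall>P P' t t'. finite_partition T \<A> P \<and> refines T P P0 \<and> (\<forall>A\<in>P. t A \<in> A) \<and>
      finite_partition T \<A> P' \<and> refines T P' P0 \<and> (\<forall>A\<in>P'. t' A \<in> A) \<longrightarrow>
      hausdorff_distance (riemann_sum \<mu> F t P) (riemann_sum \<mu> F t' P') \<le> ereal \<epsilon>)"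
proof -
  \<comment> \<open>Two errors \<open>M * \<delta>\<close> come from exchanging \<open>\<mu>\<close>
    and \<open>\<Psi>\<close>, two from dropping the tails, and one \<open>\<delta>\<close> is the
    diameter.\<close>
  define \<delta> where "\<delta> = \<epsilon> / (1 + 4 * M)"
  have "(1 + 4 * M) * \<delta> = \<epsilon>" and \<delta>: "0 < \<delta>"
    using \<open>0 < \<epsilon>\<close> M_nonneg by (auto simp: \<delta>_def)
  then have \<delta>_eq: "M * \<delta> + ((M * \<delta> + \<delta> + M * \<delta>) + M * \<delta>) = \<epsilon>"
    by (auto simp: algebra_simps)
  let ?f = "j \<circ> F"
  obtain \<Gamma> where \<Gamma>: "countable_partition T \<A> \<Gamma>"
    and summable: "\<And>t. (\<forall>A\<in>\<Gamma>. t A \<in> A) \<Longrightarrow> (\<lambda>A. \<Psi> A *\<^sub>R ?f (t A)) summable_on \<Gamma>"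
    and bdd: "bounded {infsum (\<lambda>A. \<Psi> A *\<^sub>R ?f (t A)) \<Gamma> | t. \<forall>A\<in>\<Gamma>. t A \<in> A}"
    and diam: "diameter {infsum (\<lambda>A. \<Psi> A *\<^sub>R ?f (t A)) \<Gamma> | t. \<forall>A\<in>\<Gamma>. t A \<in> A} < \<delta>"
    using birkhoff \<delta> unfolding birkhoff_integrable_def birkhoff_integrable_fun_def Let_def by meson
  obtain G P0 where G: "finite G" "G \<subseteq> \<Gamma>" "\<Psi> (T - \<Union>G) < \<delta>" and P0: "henstock_fine \<delta> P0"
    and "\<forall>P. refines T P P0 \<longrightarrow> (\<forall>A\<in>P. (\<exists>E\<in>G. A \<subseteq> E) \<or> A \<subseteq> T - \<Union>G)"
    using truncated_partition[OF \<Gamma> \<delta>] .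
  then have split: "(\<exists>E\<in>G. A \<subseteq> E) \<or> A \<subseteq> T - \<Union>G" if "refines T P P0" "A \<in> P" for P A
    using that by blast
  have \<Gamma>': "disjoint \<Gamma>" "\<Gamma> \<subseteq> \<A>" "{} \<notin> \<Gamma>"
    using \<Gamma> by (auto simp: countable_partition_def partition_on_def)
  have tail: "T - \<Union>G \<in> \<A>"
    using G(1,2) \<Gamma>'(2) by (auto intro!: finite_Union)
  define D where "D = (\<Sum>E\<in>G. (\<lambda>x. \<Psi> E *\<^sub>R ?f x) ` E)"
  have D: "norm (x - y) \<le> \<delta>" if xy: "x \<in> D" "y \<in> D" for x y
  proof -
    have rep: "\<exists>t. (\<forall>E\<in>G. t E \<in> E) \<and> x = (\<Sum>E\<in>G. \<Psi> E *\<^sub>R ?f (t E))" if x: "x \<in> D" for x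
    proof -
      obtain s where s: "x = sum s G" "\<forall>E\<in>G. s E \<in> (\<lambda>x. \<Psi> E *\<^sub>R ?f x) ` E"
        using x G(1) unfolding D_def by (auto simp: set_sum_alt)
      then have "\<forall>E\<in>G. \<exists>u. u \<in> E \<and> s E = \<Psi> E *\<^sub>R ?f u" by blast
      from bchoice[OF this] obtain t where t: "\<forall>E\<in>G. t E \<in> E \<and> s E = \<Psi> E *\<^sub>R ?f (t E)"
        by blast
      with s(1) show ?thesis by (intro exI[of _ t]) auto
    qed
    obtain tx where tx: "\<forall>E\<in>G. tx E \<in> E" "x = (\<Sum>E\<in>G. \<Psi> E *\<^sub>R ?f (tx E))"
      using rep[OF xy(1)] by blast
    obtain ty where ty: "\<forall>E\<in>G. ty E \<in> E" "y = (\<Sum>E\<in>G. \<Psi> E *\<^sub>R ?f (ty E))"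
      using rep[OF xy(2)] by blast
    obtain s where s: "\<And>A. A \<in> \<Gamma> \<Longrightarrow> s A \<in> A"
      using exists_tags[OF \<Gamma>'(3)] by blast
    \<comment> \<open>Both tag functions agree outside \<open>G\<close>, so the tails of the two
      series cancel and the diameter bound applies to the finite parts.\<close>
    define sx where "sx A = (if A \<in> G then tx A else s A)" for A
    define sy where "sy A = (if A \<in> G then ty A else s A)" for A
    have tags: "\<forall>A\<in>\<Gamma>. sx A \<in> A" "\<forall>A\<in>\<Gamma>. sy A \<in> A"
      using s tx ty by (auto simp: sx_def sy_def)
    let ?X = "infsum (\<lambda>A. \<Psi> A *\<^sub>R ?f (sx A)) \<Gamma>"
    let ?Y = "infsum (\<lambda>A. \<Psi> A *\<^sub>R ?f (sy A)) \<Gamma>"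
    have "((\<lambda>A. - (\<Psi> A *\<^sub>R ?f (sy A))) has_sum - ?Y) \<Gamma>"
      using has_sum_infsum[OF summable[OF tags(2)]] by (simp add: has_sum_uminus)
    from has_sum_add[OF has_sum_infsum[OF summable[OF tags(1)]] this]
    have "((\<lambda>A. \<Psi> A *\<^sub>R ?f (sx A) - \<Psi> A *\<^sub>R ?f (sy A)) has_sum (?X - ?Y)) \<Gamma>"
      by simp
    moreover have "((\<lambda>A. \<Psi> A *\<^sub>R ?f (sx A) - \<Psi> A *\<^sub>R ?f (sy A)) has_sum (x - y)) \<Gamma>"
    proof (rule has_sum_finite_neutralI[OF G(1,2)])
      show "x - y = (\<Sum>A\<in>G. \<Psi> A *\<^sub>R ?f (sx A) - \<Psi> A *\<^sub>R ?f (sy A))"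
        by (simp add: sx_def sy_def tx(2) ty(2) sum_subtractf)
    qed (simp add: sx_def sy_def)
    ultimately have "?X - ?Y = x - y"
      by (rule has_sum_unique)
    moreover have "dist ?X ?Y \<le> diameter {infsum (\<lambda>A. \<Psi> A *\<^sub>R ?f (t A)) \<Gamma> | t. \<forall>A\<in>\<Gamma>. t A \<in> A}"
      using tags by (intro diameter_bounded_bound[OF bdd]) blast+
    ultimately show ?thesis
      using diam by (simp add: dist_norm)
  qed
  have near_hull: "\<exists>z\<in>convex hull D. norm ((\<Sum>A\<in>P. \<Psi> A *\<^sub>R ?f (t A)) - z) \<le> M * \<delta>"
    if P: "finite_partition T \<A> P" "refines T P P0" and t: "\<And>A. A \<in> P \<Longrightarrow> t A \<in> A" for P t
  proof -
    have P': "finite P" "P \<subseteq> \<A>" "partition_on T P" "countable_partition T \<A> P"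
      using P(1) finite_imp_countable_partition by (auto simp: finite_partition_def)
    have P_nonneg: "0 \<le> \<Psi> A" if "A \<in> P" for A
      using P'(2) that integral_function_nonneg by blast
    define R where "R E = {A \<in> P. A \<subseteq> E}" for E
    define Q where "Q = \<Union>(R ` G)"
    let ?g = "\<lambda>A. \<Psi> A *\<^sub>R ?f (t A)"
    have RE: "finite (R E)" "disjoint (R E)" "R E \<subseteq> \<A>" for E
      using P' by (auto simp: R_def partition_on_def intro: pairwise_subset)
    have "R E \<inter> R E' = {}" if "E \<in> G" "E' \<in> G" "E \<noteq> E'" for E E'
    proof -
      have "E \<inter> E' = {}"
        using \<Gamma>'(1) G(2) that by (auto dest: disjointD)
      with P'(3) show ?thesis
        by (auto simp: R_def partition_on_def) (metis Int_greatest bot.extremum_uniqueI)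
    qed
    then have sumQ: "sum ?g Q = (\<Sum>E\<in>G. sum ?g (R E))"
      unfolding Q_def using G(1) RE(1) by (intro sum.UNION_disjoint) auto
    have "sum ?g (R E) \<in> convex hull ((\<lambda>x. \<Psi> E *\<^sub>R ?f x) ` E)" if E: "E \<in> G" for E
    proof -
      \<comment> \<open>A member of \<open>P\<close> that meets \<open>E\<close> does not lie in
        \<open>T - \<Union>G\<close>, so it lies in a member of \<open>G\<close>, which is
        \<open>E\<close> by disjointness.\<close>
      have "\<Union>(R E) = E"
      proof (intro equalityI subsetI)
        fix x assume "x \<in> E"
        moreover have "E \<subseteq> T" using E G(2) \<Gamma>'(2) sets_into_space by blast
        ultimately obtain A where A: "A \<in> P" "x \<in> A"
          using P'(3) unfolding partition_on_def by blast
        have "\<not> A \<subseteq> T - \<Union>G" using A(2) \<open>x \<in> E\<close> E by blast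
        then obtain E' where E': "E' \<in> G" "A \<subseteq> E'"
          using split[OF P(2) A(1)] by blast
        then have "E' = E"
          using \<Gamma>'(1) G(2) E A(2) \<open>x \<in> E\<close> disjointD[of \<Gamma> E E'] by blast
        with A E' show "x \<in> \<Union>(R E)" by (auto simp: R_def)
      qed (auto simp: R_def)
      then have "\<Psi> E = sum \<Psi> (R E)"
        using integral_function_Union[OF RE, of E] by simp
      moreover have "sum ?g (R E) \<in> convex hull ((\<lambda>x. sum \<Psi> (R E) *\<^sub>R ?f x) ` E)"
        using RE(1) t E G(2) \<Gamma>'(3) P_nonneg
        by (intro refined_sum_in_convex_hull) (auto simp: R_def)
      ultimately show ?thesis by simp
    qed
    \<comment> \<open>The convex hull of a Minkowski sum is the Minkowski sum of the convex
      hulls.\<close>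
    then have "sum ?g Q \<in> convex hull D"
      unfolding sumQ D_def convex_hull_set_sum using G(1) by (auto simp: set_sum_alt)
    moreover have "norm (sum ?g P - sum ?g Q) \<le> M * \<delta>"
    proof -
      have "sum ?g P - sum ?g Q = sum ?g (P - Q)"
        using P'(1) by (subst sum_diff) (auto simp: Q_def R_def)
      also have "norm \<dots> \<le> (\<Sum>A\<in>P - Q. M * \<Psi> A)"
      proof (rule sum_norm_le)
        fix A assume "A \<in> P - Q"
        then have "0 \<le> \<Psi> A" "norm (?f (t A)) \<le> M"
          using P_nonneg norm_radstroem_embedding_le[OF j] tags_in_space[OF P'(4) t]
          by auto
        then show "norm (?g A) \<le> M * \<Psi> A"
          by (simp add: mult.commute[of M] mult_left_mono)
      qed
      also have "\<dots> = M * (\<Sum>A\<in>P - Q. \<Psi> A)"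
        by (simp add: sum_distrib_left)
      also have "\<dots> \<le> M * \<delta>"
      proof (rule mult_left_mono[OF _ M_nonneg])
        have "\<Union>(P - Q) \<subseteq> T - \<Union>G"
          using split[OF P(2)] unfolding Q_def R_def by blast
        moreover have "subordinate_family \<A> P0 (P - Q)"
          using P'(1) by (intro subordinate_family_subset[OF P'(4) P(2)]) auto
        ultimately have "(\<Sum>A\<in>P - Q. \<Psi> A) \<le> \<Psi> (T - \<Union>G)"
          using tail by (intro subordinate_sum_le(1))
        with G(3) show "(\<Sum>A\<in>P - Q. \<Psi> A) \<le> \<delta>" by simp
      qed
      finally show ?thesis .
    qed
    ultimately show ?thesis by blast
  qed
  have "hausdorff_distance (riemann_sum \<mu> F t P) (riemann_sum \<mu> F t' P') \<le> ereal \<epsilon>"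
    if P: "finite_partition T \<A> P" "refines T P P0" and t: "\<And>A. A \<in> P \<Longrightarrow> t A \<in> A"
      and P': "finite_partition T \<A> P'" "refines T P' P0" and t': "\<And>A. A \<in> P' \<Longrightarrow> t' A \<in> A"
    for P P' t t'
  proof -
    have weights: "hausdorff_distance (riemann_sum \<mu> F t P) (riemann_sum \<Psi> F t P) \<le> ereal (M * \<delta>)"
      if P: "finite_partition T \<A> P" "refines T P P0" and t: "\<And>A. A \<in> P \<Longrightarrow> t A \<in> A" for P t
    proof -
      have "ereal (M * (\<Sum>A\<in>P. \<bar>\<mu> A - \<Psi> A\<bar>)) \<le> ereal (M * \<delta>)"
        using M_nonneg henstock_fine_sum_error[OF P0 P] by (simp add: mult_left_mono)
      with riemann_sum_weights[of P t \<mu> \<Psi>] tags_in_space[OF finite_imp_countable_partition[OF P(1)] t]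
      show ?thesis by (meson order_trans)
    qed
    have emb: "j (riemann_sum \<Psi> F t P) = (\<Sum>A\<in>P. \<Psi> A *\<^sub>R ?f (t A)) \<and> riemann_sum \<Psi> F t P \<in> cwk"
      if P: "finite_partition T \<A> P" and t: "\<And>A. A \<in> P \<Longrightarrow> t A \<in> A" for P t
    proof -
      have "\<And>A. A \<in> P \<Longrightarrow> t A \<in> T"
        using tags_in_space[OF finite_imp_countable_partition[OF P] t] .
      then show ?thesis
        using P integral_function_nonneg radstroem_embedding_riemann_sum[OF j, of P t \<Psi>]
          riemann_sum_cwk[of P t \<Psi>] by (auto simp: finite_partition_def)
    qed
    obtain z where z: "z \<in> convex hull D" "norm ((\<Sum>A\<in>P. \<Psi> A *\<^sub>R ?f (t A)) - z) \<le> M * \<delta>"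
      using near_hull[OF P t] by blast
    obtain z' where z': "z' \<in> convex hull D" "norm ((\<Sum>A\<in>P'. \<Psi> A *\<^sub>R ?f (t' A)) - z') \<le> M * \<delta>"
      using near_hull[OF P' t'] by blast
    have "norm (z - z') \<le> \<delta>"
      using D z(1) z'(1) by (rule dist_convex_hull_le)
    then have "dist z z' \<le> \<delta>" "dist (\<Sum>A\<in>P. \<Psi> A *\<^sub>R ?f (t A)) z \<le> M * \<delta>"
      "dist z' (\<Sum>A\<in>P'. \<Psi> A *\<^sub>R ?f (t' A)) \<le> M * \<delta>"
      using z(2) z'(2) by (simp_all only: dist_norm norm_minus_commute[of z'])
    then have "dist (\<Sum>A\<in>P. \<Psi> A *\<^sub>R ?f (t A)) (\<Sum>A\<in>P'. \<Psi> A *\<^sub>R ?f (t' A)) \<le> M * \<delta> + \<delta> + M * \<delta>"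
      using dist_triangle[of "\<Sum>A\<in>P. \<Psi> A *\<^sub>R ?f (t A)" "\<Sum>A\<in>P'. \<Psi> A *\<^sub>R ?f (t' A)" z]
        dist_triangle[of z "\<Sum>A\<in>P'. \<Psi> A *\<^sub>R ?f (t' A)" z'] by linarith
    then have "norm ((\<Sum>A\<in>P. \<Psi> A *\<^sub>R ?f (t A)) - (\<Sum>A\<in>P'. \<Psi> A *\<^sub>R ?f (t' A))) \<le> M * \<delta> + \<delta> + M * \<delta>"
      by (simp only: dist_norm)
    then have "hausdorff_distance (riemann_sum \<Psi> F t P) (riemann_sum \<Psi> F t' P')
        \<le> ereal (M * \<delta> + \<delta> + M * \<delta>)"
      using emb[OF P(1) t] emb[OF P'(1) t'] by (simp add: norm_radstroem_embedding_diff[OF j])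
    moreover have "hausdorff_distance (riemann_sum \<Psi> F t' P') (riemann_sum \<mu> F t' P') \<le> ereal (M * \<delta>)"
      using weights[OF P' t'] by (simp add: hausdorff_distance_commute)
    ultimately have "hausdorff_distance (riemann_sum \<Psi> F t P) (riemann_sum \<mu> F t' P')
        \<le> ereal ((M * \<delta> + \<delta> + M * \<delta>) + M * \<delta>)"
      by (rule hausdorff_distance_triangle)
    with weights[OF P t]
    have "hausdorff_distance (riemann_sum \<mu> F t P) (riemann_sum \<mu> F t' P')
        \<le> ereal (M * \<delta> + ((M * \<delta> + \<delta> + M * \<delta>) + M * \<delta>))"
      by (rule hausdorff_distance_triangle)
    then show ?thesis by (simp only: \<delta>_eq)
  qed
  with henstock_fine_partition[OF P0] show ?thesis
    by (intro exI[of _ P0] conjI allI impI) auto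
qed

lemma birkhoff_imp_gould:
  assumes birkhoff: "birkhoff_integrable j T \<A> \<Psi> F" and j: "radstroem_embedding j"
  shows "gould_integrable T \<A> \<mu> F"
proof -
  define good where "good \<epsilon> P0 \<longleftrightarrow> finite_partition T \<A> P0 \<and>
    (\<forall>P P' t t'. finite_partition T \<A> P \<and> refines T P P0 \<and> (\<forall>A\<in>P. t A \<in> A) \<and>
      finite_partition T \<A> P' \<and> refines T P' P0 \<and> (\<forall>A\<in>P'. t' A \<in> A) \<longrightarrow>
      hausdorff_distance (riemann_sum \<mu> F t P) (riemann_sum \<mu> F t' P') \<le> ereal \<epsilon>)" for \<epsilon> P0
  have "\<exists>P0. good (1 / 2 ^ n) P0" for n :: nat
    unfolding good_def by (rule birkhoff_imp_gould_Cauchy[OF birkhoff j]) simp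
  then obtain P0 where P0: "\<And>n. good (1 / 2 ^ n) (P0 n)"
    by metis
  have P0_part: "finite_partition T \<A> (P0 n)" for n
    using P0 by (simp add: good_def)
  \<comment> \<open>Refining all earlier \<open>P0 i\<close> makes \<open>R n\<close> and
    \<open>R (Suc n)\<close> both finer than \<open>P0 n\<close>, so that consecutive sums can be
    compared.\<close>
  have "\<exists>P. finite_partition T \<A> P \<and> (\<forall>i\<le>n. refines T P (P0 i))" for n
  proof -
    have "\<forall>\<^sub>F P in \<F>. \<forall>i\<in>{..n}. finite_partition T \<A> P \<and> refines T P (P0 i)"
      using eventually_refines[OF P0_part] by (intro eventually_ball_finite) auto
    then show ?thesis
      using eventually_happens'[OF partition_filter_nontrivial] by fastforce
  qed
  then obtain R where R: "\<And>n. finite_partition T \<A> (R n)" "\<And>n i. i \<le> n \<Longrightarrow> refines T (R n) (P0 i)"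
    by metis
  have "\<exists>t. \<forall>A\<in>R n. t A \<in> A" for n
    using exists_tags[of "R n"] R(1)[of n] unfolding finite_partition_def partition_on_def by metis
  then obtain t where t: "\<And>n A. A \<in> R n \<Longrightarrow> t n A \<in> A"
    by metis
  define S where "S n = riemann_sum \<mu> F (t n) (R n)" for n
  have tags: "\<And>A. A \<in> R n \<Longrightarrow> t n A \<in> T" for n
    using tags_in_space[OF finite_imp_countable_partition[OF R(1)] t] .
  have Cauchy: "hausdorff_distance (S n) (S (Suc n)) \<le> ereal (1 / 2 ^ n)" for n
    using P0[of n] R(1)[of n] R(1)[of "Suc n"] R(2)[of n n] R(2)[of n "Suc n"] t
    unfolding good_def S_def by (simp del: ereal_less_eq)
  have "S n \<noteq> {}" for n
    using riemann_sum_cwk[OF tags] by (auto simp: S_def cwk_def)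
  from hausdorff_distance_limit[OF this Cauchy] obtain I
    where I: "closed I" "I \<noteq> {}" "\<forall>n. hausdorff_distance (S n) I \<le> ereal (4 / 2 ^ n)"
    by metis
  have "bounded (S 0)"
    using R(1) tags unfolding S_def by (intro bounded_riemann_sum) (auto simp: finite_partition_def)
  then have "bounded I"
    using I(3) by (blast intro: bounded_hausdorff_distance)
  with I have "I \<in> bf" by (simp add: bf_def)
  moreover have "\<exists>P0. finite_partition T \<A> P0 \<and>
      (\<forall>P t. finite_partition T \<A> P \<and> refines T P P0 \<and> (\<forall>A\<in>P. t A \<in> A) \<longrightarrow>
        hausdorff_distance (riemann_sum \<mu> F t P) I < ereal \<epsilon>)" if "0 < \<epsilon>" for \<epsilon> :: real
  proof -
    \<comment> \<open>One fifth for the distance to \<open>S n\<close>, four fifths for the distance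
      from \<open>S n\<close> to \<open>I\<close>.\<close>
    obtain n where n: "(1 / 2) ^ n < \<epsilon> / 5"
      using real_arch_pow_inv[of "\<epsilon>/5" "1/2"] \<open>0 < \<epsilon>\<close> by auto
    then have small: "1 / 2 ^ n + 4 / 2 ^ n < \<epsilon>"
      by (simp add: power_divide)
    have "hausdorff_distance (riemann_sum \<mu> F s P) I < ereal \<epsilon>"
      if "finite_partition T \<A> P" "refines T P (P0 n)" "\<forall>A\<in>P. s A \<in> A" for P s
    proof -
      have "hausdorff_distance (riemann_sum \<mu> F s P) (S n) \<le> ereal (1 / 2 ^ n)"
        using P0[of n] that R(1)[of n] R(2)[of n n] t unfolding good_def S_def by simp
      then have "hausdorff_distance (riemann_sum \<mu> F s P) I \<le> ereal (1 / 2 ^ n + 4 / 2 ^ n)"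
        using I(3) by (blast intro: hausdorff_distance_triangle)
      also have "\<dots> < ereal \<epsilon>" using small by simp
      finally show ?thesis .
    qed
    with P0_part show ?thesis by blast
  qed
  ultimately show ?thesis
    unfolding gould_integrable_def riemann_sum_def[symmetric]
    by (intro bexI[of _ I]) simp_all
qed

end

text \<open>The equivalence of (i) and (iii) stands outside the quantifier over \<open>j\<close>, so
  it does not depend on the existence of an embedding for the chosen type of
  \<open>\<Omega>\<close>.\<close>

theorem theorem3p13:
  fixes T :: "'a set" and \<A> :: "'a set set" and \<mu> :: "'a set \<Rightarrow> real"
    and F :: "'a \<Rightarrow> 'x::banach set"
  assumes "uncountable T"
    and "sigma_algebra T \<A>"
    and "\<forall>A\<in>\<A>. 0 \<le> \<mu> A"
    and "mono_on \<A> \<mu>"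
    and "\<mu> {} = 0"
    and "\<mu> T > 0"
    and "integrable_set_function T \<A> \<mu>"
    and "\<forall>A :: nat \<Rightarrow> 'a set. range A \<subseteq> \<A> \<and> incseq A \<longrightarrow> (\<lambda>n. \<mu> (A n)) \<longlonglongrightarrow> \<mu> (\<Union>n. A n)"
    and "\<forall>t\<in>T. F t \<in> cwk"
    and "bounded_multifunction T F"
  shows "(birkhoff_simple_integrable T \<A> \<mu> F \<longleftrightarrow> gould_integrable T \<A> \<mu> F) \<and>
    (\<forall>j :: 'x set \<Rightarrow> ('w::t2_space \<Rightarrow>\<^sub>C real). radstroem_embedding j \<longrightarrow>
      (birkhoff_simple_integrable T \<A> \<mu> F \<longleftrightarrow>
        birkhoff_integrable j T \<A> (integral_function T \<A> \<mu>) F))"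
proof -
  obtain M where M: "0 \<le> M" "\<And>x y. x \<in> T \<Longrightarrow> y \<in> F x \<Longrightarrow> norm y \<le> M"
  proof -
    from assms(10) obtain m where m: "(SUP t\<in>T. set_size (F t)) < ereal m"
      unfolding bounded_multifunction_def by (meson ereal_dense2)
    have "norm y \<le> m" if "x \<in> T" "y \<in> F x" for x y
    proof -
      have "ereal (norm y) \<le> set_size (F x)"
        unfolding set_size_def using that(2) by (rule SUP_upper)
      also have "\<dots> \<le> (SUP t\<in>T. set_size (F t))"
        using that(1) by (rule SUP_upper)
      finally have "ereal (norm y) < ereal m"
        using m by (rule le_less_trans)
      then show ?thesis by simp
    qed
    then show thesis
      \<comment> \<open>The bound \<open>m\<close> comes from a comparison of extended reals and
        carries no sign, hence the maximum with 0.\<close>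
      by (intro that[of "max m 0"]) (auto intro: le_max_iff_disj[THEN iffD2])
  qed
  interpret sigma_algebra T \<A> by fact
  interpret bounded_integrand T \<A> \<mu> F M
    by unfold_locales (use assms M in auto)
  show ?thesis
    using birkhoff_simple_imp_gould gould_imp_birkhoff_simple gould_imp_birkhoff birkhoff_imp_gould
    by blast
qed

end
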